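(* Let $1\le p<\infty$, let $K$ be a dispersed compact Hausdorff space, let $X,Y$ be Banach spaces, and let $m\leftrightarrow T:C(K,X)\to Y$ be a strongly bounded operator. Then $T$ is weak Dunford-Pettis (respectively weak$^*$ Dunford-Pettis, weak $p$-convergent, weak$^*$ $p$-convergent) if and only if for each $A\in\Sigma$ the operator $m(A):X\to Y$ is weak Dunford-Pettis (respectively weak$^*$ Dunford-Pettis, weak $p$-convergent, weak$^*$ $p$-convergent).
   Context: Operator means bounded linear map. $C(K,X)$ is the space of continuous functions $K\to X$ with the sup norm; $\Sigma$ is the Borel $\sigma$-algebra of $K$. Its dual is $rcabv(\Sigma,X^* )$, the regular countably additive $X^*$-valued Borel measures of bounded variation. Every operator $T:C(K,X)\to Y$ has a representing measure $m:\Sigma\to L(X,Y^{**})$ (written $m\leftrightarrow T$), $m(A)x=T^{**}(\chi_A x)$, where $\chi_A x\in C(K,X)^{**}$ acts on $\mu\in rcabv(\Sigma,X^* )$ by $\langle \mu(A),x\rangle$; one has $T(f)=\int_K f\,dm$. For $y^*\in Y^*$ put $y^*m=T^*(y^* )\in rcabv(\Sigma,X^* )$, so $\langle y^*m(A),x\rangle=\langle m(A)x,y^*\rangle$. The semivariation is $\tilde m(E)=\sup\{|y^*m|(E): \|y^*\|\le 1\}$, with $|\cdot|$ denoting variation. $T$ (or $m$) is strongly bounded if $\tilde m(A_i)\to 0$ for every decreasing sequence $(A_i)$ in $\Sigma$ with empty intersection; in that case $m$ takes values in $L(X,Y)$. A topological space is dispersed (scattered) if every nonempty closed subset has an isolated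 point. A sequence $(x_n)$ in a Banach space $E$ is weakly $p$-summable if $(x^*(x_n))\in\ell_p$ for all $x^*\in E^*$. An operator $S:E\to F$ between Banach spaces is weak Dunford-Pettis (resp. weak$^*$ Dunford-Pettis) if $\langle S(x_n),y_n^*\rangle\to 0$ whenever $(x_n)$ is weakly null in $E$ and $(y_n^* )$ is weakly null (resp. $w^*$-null) in $F^*$; it is weak $p$-convergent (resp. weak$^*$ $p$-convergent) if $\langle S(x_n),y_n^*\rangle\to 0$ whenever $(x_n)$ is weakly $p$-summable in $E$ and $(y_n^* )$ is weakly null (resp. $w^*$-null) in $F^*$. *)

theory Defs
  imports "HOL-Analysis.Analysis"
begin

section \<open>Dual spaces, adjoints and the canonical embedding\<close>

type_synonym 'a dual = "'a \<Rightarrow>\<^sub>L real"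

type_synonym 'a bidual = "'a dual dual"

lift_definition canonical_embedding :: "'a::real_normed_vector \<Rightarrow>\<^sub>L 'a bidual"
  is "\<lambda>x. Blinfun (\<lambda>\<phi>. blinfun_apply \<phi> x)"
proof (rule bounded_linear_intro [where K = 1])
  fix x y :: 'a and r :: real
  have ap: "blinfun_apply (Blinfun (\<lambda>\<phi>::'a dual. blinfun_apply \<phi> z)) = (\<lambda>\<phi>. blinfun_apply \<phi> z)" for z
    by (rule bounded_linear_Blinfun_apply) (rule blinfun.bounded_linear_left)
  show "Blinfun (\<lambda>\<phi>::'a dual. blinfun_apply \<phi> (x + y)) =
      Blinfun (\<lambda>\<phi>. blinfun_apply \<phi> x) + Blinfun (\<lambda>\<phi>. blinfun_apply \<phi> y)"
    by (rule blinfun_eqI) (simp only: ap blinfun.add_left, rule blinfun.add_right)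
  show "Blinfun (\<lambda>\<phi>::'a dual. blinfun_apply \<phi> (r *\<^sub>R x)) = r *\<^sub>R Blinfun (\<lambda>\<phi>. blinfun_apply \<phi> x)"
    by (rule blinfun_eqI) (simp only: ap blinfun.scaleR_left, rule blinfun.scaleR_right)
  show "norm (Blinfun (\<lambda>\<phi>::'a dual. blinfun_apply \<phi> x)) \<le> norm x * 1"
    by (rule norm_blinfun_bound) (simp_all only: ap mult_1_right norm_ge_zero, metis mult.commute norm_blinfun)
qed

lemma canonical_embedding_apply [simp]:
  "blinfun_apply (blinfun_apply canonical_embedding x) \<phi> = blinfun_apply \<phi> x"
  by (simp add: canonical_embedding.rep_eq bounded_linear_Blinfun_apply blinfun.bounded_linear_left)

lift_definition adjoint ::
  "('a::real_normed_vector \<Rightarrow>\<^sub>L 'b::real_normed_vector) \<Rightarrow> 'b dual \<Rightarrow>\<^sub>L 'a dual"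
  is "\<lambda>T \<phi>. \<phi> o\<^sub>L T"
  by (rule bounded_bilinear.bounded_linear_left [OF bounded_bilinear_blinfun_compose])

text \<open>An operator into \<open>Y\<^sup>*\<^sup>*\<close> whose values lie in the canonical image of \<open>Y\<close>, regarded as an
  operator into \<open>Y\<close>. It is uniquely determined because the canonical embedding is injective, and
  unspecified if \<open>R\<close> has a value outside the canonical image.\<close>

definition into_space ::
  "('x::real_normed_vector \<Rightarrow>\<^sub>L 'y::real_normed_vector bidual) \<Rightarrow> ('x \<Rightarrow>\<^sub>L 'y)"
  where "into_space R = (THE S. canonical_embedding o\<^sub>L S = R)"

section \<open>Regular vector measures of bounded variation\<close>

text \<open>Set functions are total on all sets; only their values on Borel sets matter.\<close>

definition variation :: "('k::topological_space set \<Rightarrow> 'v::real_normed_vector) \<Rightarrow> 'k set \<Rightarrow> ennreal"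
  where "variation \<mu> E =
    (SUP P \<in> {P. finite P \<and> disjoint P \<and> P \<subseteq> sets borel \<and> \<Union>P = E}. \<Sum>A\<in>P. ennreal (norm (\<mu> A)))"

definition rcabv :: "('k::topological_space set \<Rightarrow> 'v::real_normed_vector) set"
  where "rcabv = {\<mu>.
    (\<forall>A :: nat \<Rightarrow> 'k set. range A \<subseteq> sets borel \<and> disjoint_family A \<longrightarrow>
       (\<lambda>i. \<mu> (A i)) sums \<mu> (\<Union>i. A i)) \<and>
    variation \<mu> UNIV < \<infinity> \<and>
    (\<forall>A \<in> sets borel. \<forall>\<epsilon>>0. \<exists>C U. compact C \<and> open U \<and> C \<subseteq> A \<and> A \<subseteq> U \<and> variation \<mu> (U - C) < \<epsilon>)}"

definition simple_integral_vm ::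
  "('k::topological_space set \<Rightarrow> 'x::real_normed_vector dual) \<Rightarrow> ('k \<Rightarrow> 'x) \<Rightarrow> real"
  where "simple_integral_vm \<mu> s = (\<Sum>v \<in> range s. blinfun_apply (\<mu> (s -` {v})) v)"

text \<open>The integral of a uniform limit of Borel simple functions. For \<open>\<mu> \<in> rcabv\<close> the value does
  not depend on the approximating sequence, and on a compact space every continuous function is
  such a limit.\<close>

definition has_integral_vm ::
  "('k::topological_space set \<Rightarrow> 'x::real_normed_vector dual) \<Rightarrow> ('k \<Rightarrow> 'x) \<Rightarrow> real \<Rightarrow> bool"
  where "has_integral_vm \<mu> f I \<longleftrightarrow>
    (\<exists>s. (\<forall>n. simple_function borel (s n)) \<and> uniform_limit UNIV s f sequentially \<and>
         (\<lambda>n. simple_integral_vm \<mu> (s n)) \<longlonglongrightarrow> I)"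

section \<open>Representing measures of operators on \<open>C(K,X)\<close>\<close>

text \<open>For compact \<open>K\<close> the type \<open>'k \<Rightarrow>\<^sub>C 'x\<close> of bounded continuous functions is \<open>C(K,X)\<close>. The
  following is the inverse of the isomorphism of \<open>rcabv(\<Sigma>,X\<^sup>*)\<close> with the dual of \<open>C(K,X)\<close>;
  the chosen set function is unique on the Borel sets.\<close>

definition measure_of_functional ::
  "('k::topological_space \<Rightarrow>\<^sub>C 'x::real_normed_vector) dual \<Rightarrow> 'k set \<Rightarrow> 'x dual"
  where "measure_of_functional \<phi> =
    (SOME \<mu>. \<mu> \<in> rcabv \<and> (\<forall>f. has_integral_vm \<mu> (apply_bcontfun f) (blinfun_apply \<phi> f)))"

text \<open>The element \<open>\<chi>\<^sub>A x\<close> of the bidual of \<open>C(K,X)\<close>.\<close>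

definition indicator_bidual ::
  "'k::topological_space set \<Rightarrow> 'x::real_normed_vector \<Rightarrow> ('k \<Rightarrow>\<^sub>C 'x) bidual"
  where "indicator_bidual A x = Blinfun (\<lambda>\<phi>. blinfun_apply (measure_of_functional \<phi> A) x)"

definition representing_measure ::
  "('k::topological_space set \<Rightarrow> 'x::real_normed_vector \<Rightarrow>\<^sub>L 'y::real_normed_vector bidual) \<Rightarrow>
   (('k \<Rightarrow>\<^sub>C 'x) \<Rightarrow>\<^sub>L 'y) \<Rightarrow> bool"
  where "representing_measure m T \<longleftrightarrow>
    (\<forall>A \<in> sets borel. \<forall>x.
       blinfun_apply (m A) x = blinfun_apply (adjoint (adjoint T)) (indicator_bidual A x))"

text \<open>The measure \<open>y\<^sup>*m\<close>, that is \<open>\<langle>y\<^sup>*m(A), x\<rangle> = \<langle>m(A)x, y\<^sup>*\<rangle>\<close>.\<close>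

definition functional_measure ::
  "'y::real_normed_vector dual \<Rightarrow> ('k set \<Rightarrow> 'x::real_normed_vector \<Rightarrow>\<^sub>L 'y bidual) \<Rightarrow> 'k set \<Rightarrow> 'x dual"
  where "functional_measure \<psi> m A = blinfun_apply canonical_embedding \<psi> o\<^sub>L m A"

definition semivariation ::
  "('k::topological_space set \<Rightarrow> 'x::real_normed_vector \<Rightarrow>\<^sub>L 'y::real_normed_vector bidual) \<Rightarrow>
   'k set \<Rightarrow> ennreal"
  where "semivariation m E = (SUP \<psi> \<in> {\<psi>. norm \<psi> \<le> 1}. variation (functional_measure \<psi> m) E)"

definition strongly_bounded ::
  "('k::topological_space set \<Rightarrow> 'x::real_normed_vector \<Rightarrow>\<^sub>L 'y::real_normed_vector bidual) \<Rightarrow> bool"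
  where "strongly_bounded m \<longleftrightarrow>
    (\<forall>A :: nat \<Rightarrow> 'k set. range A \<subseteq> sets borel \<and> decseq A \<and> (\<Inter>i. A i) = {} \<longrightarrow>
       (\<lambda>i. semivariation m (A i)) \<longlonglongrightarrow> 0)"

section \<open>Dispersed spaces\<close>

definition dispersed :: "'a::topological_space set \<Rightarrow> bool"
  where "dispersed S \<longleftrightarrow>
    (\<forall>C. closedin (top_of_set S) C \<and> C \<noteq> {} \<longrightarrow> (\<exists>x. x isolated_in C))"

section \<open>Classes of operators\<close>

definition weakly_null :: "(nat \<Rightarrow> 'e::real_normed_vector) \<Rightarrow> bool"
  where "weakly_null x \<longleftrightarrow> (\<forall>\<phi> :: 'e dual. (\<lambda>n. blinfun_apply \<phi> (x n)) \<longlonglongrightarrow> 0)"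

definition weak_star_null :: "(nat \<Rightarrow> 'e::real_normed_vector dual) \<Rightarrow> bool"
  where "weak_star_null \<phi> \<longleftrightarrow> (\<forall>x. (\<lambda>n. blinfun_apply (\<phi> n) x) \<longlonglongrightarrow> 0)"

definition weakly_p_summable :: "real \<Rightarrow> (nat \<Rightarrow> 'e::real_normed_vector) \<Rightarrow> bool"
  where "weakly_p_summable p x \<longleftrightarrow>
    (\<forall>\<phi> :: 'e dual. summable (\<lambda>n. \<bar>blinfun_apply \<phi> (x n)\<bar> powr p))"

definition weak_dunford_pettis :: "('e::real_normed_vector \<Rightarrow>\<^sub>L 'f::real_normed_vector) \<Rightarrow> bool"
  where "weak_dunford_pettis S \<longleftrightarrow>
    (\<forall>(x :: nat \<Rightarrow> 'e) (\<psi> :: nat \<Rightarrow> 'f dual). weakly_null x \<and> weakly_null \<psi> \<longrightarrow>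
       (\<lambda>n. blinfun_apply (\<psi> n) (blinfun_apply S (x n))) \<longlonglongrightarrow> 0)"

definition weak_star_dunford_pettis :: "('e::real_normed_vector \<Rightarrow>\<^sub>L 'f::real_normed_vector) \<Rightarrow> bool"
  where "weak_star_dunford_pettis S \<longleftrightarrow>
    (\<forall>(x :: nat \<Rightarrow> 'e) (\<psi> :: nat \<Rightarrow> 'f dual). weakly_null x \<and> weak_star_null \<psi> \<longrightarrow>
       (\<lambda>n. blinfun_apply (\<psi> n) (blinfun_apply S (x n))) \<longlonglongrightarrow> 0)"

definition weak_p_convergent :: "real \<Rightarrow> ('e::real_normed_vector \<Rightarrow>\<^sub>L 'f::real_normed_vector) \<Rightarrow> bool"
  where "weak_p_convergent p S \<longleftrightarrow>
    (\<forall>(x :: nat \<Rightarrow> 'e) (\<psi> :: nat \<Rightarrow> 'f dual). weakly_p_summable p x \<and> weakly_null \<psi> \<longrightarrow>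
       (\<lambda>n. blinfun_apply (\<psi> n) (blinfun_apply S (x n))) \<longlonglongrightarrow> 0)"

definition weak_star_p_convergent :: "real \<Rightarrow> ('e::real_normed_vector \<Rightarrow>\<^sub>L 'f::real_normed_vector) \<Rightarrow> bool"
  where "weak_star_p_convergent p S \<longleftrightarrow>
    (\<forall>(x :: nat \<Rightarrow> 'e) (\<psi> :: nat \<Rightarrow> 'f dual). weakly_p_summable p x \<and> weak_star_null \<psi> \<longrightarrow>
       (\<lambda>n. blinfun_apply (\<psi> n) (blinfun_apply S (x n))) \<longlonglongrightarrow> 0)"

end

theory Submission
  imports Defs
begin

text \<open>On a dispersed compact space every functional \<open>\<phi>\<close> on \<open>C(K,X)\<close> is atomic: up to \<open>\<epsilon>\<close> it
  depends only on the values at finitely many points. (Call an open set good if this holds for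
  functions supported in it; good sets are closed under unions, and an isolated point of the
  complement of the largest good set could be added to it.) Hence \<open>\<phi>\<close> extends to all bounded
  functions, which gives its representing measure without a general Riesz theorem. Strong
  boundedness of \<open>m\<close> makes the atomicity uniform over the unit ball of \<open>Y\<^sup>*\<close>. So \<open>T(f)\<close> is, up to
  \<open>\<epsilon> \<parallel>f\<parallel>\<close>, a finite sum of \<open>m({t}) f(t)\<close>, while \<open>m(A) x\<close> is, up to \<open>\<epsilon> \<parallel>x\<parallel>\<close>, of the form
  \<open>T(h x)\<close> with \<open>h\<close> a fixed scalar function. All four classes are stable under these
  approximations because the sequences involved are norm bounded.\<close>

section \<open>Norming functionals and uniform boundedness\<close>

text \<open>The measure of a functional is given through \<open>SOME\<close>, the element
  \<open>\<chi>_A x\<close> through \<open>Blinfun\<close>, and \<open>m(A)\<close> as an operator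
  into \<open>Y\<close> through \<open>THE\<close>. None of these is informative before existence,
  linearity or uniqueness is known, and this shapes the middle of the proof. Uniqueness on Borel
  sets and linearity in the functional come from one Urysohn function \<open>h\<close> serving
  several measures at once, because \<open>\<phi> \<mapsto> \<phi>(h x)\<close> is visibly linear.
  That \<open>m(A)\<close> maps into \<open>Y\<close> follows since \<open>m(A) x\<close> is a limit
  of vectors \<open>T(h x)\<close> and \<open>Y\<close> is complete. Strong boundedness speaks of
  decreasing sequences of sets, whereas the approximations need one finite set outside which all
  measures \<open>y* m\<close> with \<open>\<parallel>y*\<parallel> \<le> 1\<close> have small
  variation. Hahn-Banach makes the canonical embedding isometric; together with uniform boundedness
  this bounds all sequences that occur.\<close>

definition sublinear :: "('a::real_vector \<Rightarrow> real) \<Rightarrow> bool"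
  where "sublinear q \<longleftrightarrow> (\<forall>x y. q (x + y) \<le> q x + q y) \<and> (\<forall>c>0. \<forall>x. q (c *\<^sub>R x) = c * q x)"

section \<open>The Hahn-Banach theorem by minimal sublinear functionals\<close>

lemma sublinear_zero: "sublinear q \<Longrightarrow> q 0 = 0"
proof -
  assume "sublinear q"
  then have "q (2 *\<^sub>R 0) = 2 * q 0" unfolding sublinear_def by (metis zero_less_numeral)
  then show "q 0 = 0" by simp
qed

lemma sublinear_scaleR_nonneg: "sublinear q \<Longrightarrow> 0 \<le> c \<Longrightarrow> q (c *\<^sub>R x) = c * q x"
  by (metis less_eq_real_def mult_zero_left scaleR_zero_left sublinear_def sublinear_zero)

lemma sublinear_norm: "sublinear (norm :: 'a::real_normed_vector \<Rightarrow> real)"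
  by (simp add: sublinear_def norm_triangle_ineq)

text \<open>Lowers \<open>q\<close> in the direction \<open>a\<close>: \<open>t = 0\<close> keeps
  the result below \<open>q\<close>, and \<open>t = 1\<close> makes its value at \<open>- a\<close>
  at most \<open>- q a\<close>. A minimal functional cannot be lowered in this way, which makes it
  additive; applied to the norm, the same formula yields norming functionals.\<close>

definition sublinear_shift :: "('a::real_vector \<Rightarrow> real) \<Rightarrow> 'a \<Rightarrow> 'a \<Rightarrow> real"
  where "sublinear_shift q a x = (INF t\<in>{0..}. q (x + t *\<^sub>R a) - t * q a)"

text \<open>Makes the infimum one over a set bounded below; otherwise \<open>INF\<close> on the
  reals would carry no information.\<close>

lemma sublinear_shift_lower:
  assumes "sublinear q" "0 \<le> t"
  shows "- q (- x) \<le> q (x + t *\<^sub>R a) - t * q a"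
proof -
  have "q (t *\<^sub>R a) \<le> q (x + t *\<^sub>R a) + q (- x)"
    using assms(1) unfolding sublinear_def by (metis add.commute add_minus_cancel)
  then show ?thesis using sublinear_scaleR_nonneg[OF assms, of a] by simp
qed

lemma sublinear_shift_le:
  assumes "sublinear q" "0 \<le> t"
  shows "sublinear_shift q a x \<le> q (x + t *\<^sub>R a) - t * q a"
  unfolding sublinear_shift_def
proof (rule cINF_lower)
  show "bdd_below ((\<lambda>t. q (x + t *\<^sub>R a) - t * q a) ` {0..})"
    using sublinear_shift_lower[OF assms(1)] by (intro bdd_belowI2[where m="- q (- x)"]) auto
qed (use assms in auto)

lemma sublinear_shift_greatest:
  assumes "\<And>t. 0 \<le> t \<Longrightarrow> c \<le> q (x + t *\<^sub>R a) - t * q a"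
  shows "c \<le> sublinear_shift q a x"
  unfolding sublinear_shift_def by (rule cINF_greatest) (use assms in auto)

lemma sublinear_sublinear_shift:
  assumes q: "sublinear q"
  shows "sublinear (sublinear_shift q a)"
  unfolding sublinear_def
proof safe
  fix x y
  \<comment> \<open>Parameters \<open>t\<close> for \<open>x\<close> and \<open>s\<close> for
    \<open>y\<close> combine to \<open>t + s\<close> for \<open>x + y\<close>; the infima over
    \<open>s\<close> and \<open>t\<close> are then taken one after the other.\<close>
  have "sublinear_shift q a (x + y) - (q (x + t *\<^sub>R a) - t * q a) \<le> q (y + s *\<^sub>R a) - s * q a"
    if "0 \<le> s" "0 \<le> t" for s t
  proof -
    have "sublinear_shift q a (x + y) \<le> q ((x + y) + (t + s) *\<^sub>R a) - (t + s) * q a"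
      using that by (intro sublinear_shift_le q) auto
    also have "(x + y) + (t + s) *\<^sub>R a = (x + t *\<^sub>R a) + (y + s *\<^sub>R a)"
      by (simp add: algebra_simps)
    also have "q \<dots> \<le> q (x + t *\<^sub>R a) + q (y + s *\<^sub>R a)"
      using q unfolding sublinear_def by blast
    finally show ?thesis by (simp add: algebra_simps)
  qed
  then have "sublinear_shift q a (x + y) - (q (x + t *\<^sub>R a) - t * q a) \<le> sublinear_shift q a y"
    if "0 \<le> t" for t
    using that by (intro sublinear_shift_greatest) auto
  then have "sublinear_shift q a (x + y) - sublinear_shift q a y \<le> q (x + t *\<^sub>R a) - t * q a"
    if "0 \<le> t" for t
    using that by (simp add: algebra_simps)
  then have "sublinear_shift q a (x + y) - sublinear_shift q a y \<le> sublinear_shift q a x"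
    by (intro sublinear_shift_greatest) auto
  then show "sublinear_shift q a (x + y) \<le> sublinear_shift q a x + sublinear_shift q a y"
    by simp
next
  \<comment> \<open>One inequality suffices: with \<open>1 / c\<close> in place of \<open>c\<close>
    it gives the reverse one.\<close>
  have half: "sublinear_shift q a (c *\<^sub>R x) \<le> c * sublinear_shift q a x" if "0 < c" for c x
  proof -
    have "sublinear_shift q a (c *\<^sub>R x) / c \<le> q (x + t *\<^sub>R a) - t * q a" if "0 \<le> t" for t
    proof -
      have "sublinear_shift q a (c *\<^sub>R x) \<le> q (c *\<^sub>R x + (c * t) *\<^sub>R a) - (c * t) * q a"
        using that \<open>0 < c\<close> by (intro sublinear_shift_le q) auto
      also have "c *\<^sub>R x + (c * t) *\<^sub>R a = c *\<^sub>R (x + t *\<^sub>R a)"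
        by (simp add: algebra_simps)
      also have "q \<dots> = c * q (x + t *\<^sub>R a)"
        using q \<open>0 < c\<close> by (simp add: sublinear_def)
      finally show ?thesis using \<open>0 < c\<close> by (simp add: field_simps)
    qed
    then have "sublinear_shift q a (c *\<^sub>R x) / c \<le> sublinear_shift q a x"
      by (rule sublinear_shift_greatest)
    then show ?thesis using that by (simp add: field_simps)
  qed
  fix c :: real and x
  assume c: "0 < c"
  have "sublinear_shift q a ((1 / c) *\<^sub>R (c *\<^sub>R x)) \<le> (1 / c) * sublinear_shift q a (c *\<^sub>R x)"
    by (rule half) (use c in auto)
  then have "c * sublinear_shift q a x \<le> sublinear_shift q a (c *\<^sub>R x)"
    using c by (simp add: field_simps)
  with half[OF c, of x] show "sublinear_shift q a (c *\<^sub>R x) = c * sublinear_shift q a x"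
    by simp
qed

lemma sublinear_shift_le_self: "sublinear q \<Longrightarrow> sublinear_shift q a \<le> q"
  using sublinear_shift_le[of q 0 a] by (simp add: le_fun_def)

text \<open>For a general family subadditivity can fail, because a functional that is small at
  \<open>x\<close> need not be small at \<open>y\<close>. In a chain the smaller of two functionals
  serves at both points.\<close>

lemma sublinear_INF_chain:
  fixes C :: "('a::real_vector \<Rightarrow> real) set"
  assumes "C \<noteq> {}" and sub: "\<And>q. q \<in> C \<Longrightarrow> sublinear q"
    and tot: "\<And>q r. q \<in> C \<Longrightarrow> r \<in> C \<Longrightarrow> q \<le> r \<or> r \<le> q"
    and bdd: "\<And>x. bdd_below ((\<lambda>q. q x) ` C)"
  shows "sublinear (\<lambda>x. INF q\<in>C. q x)"
  unfolding sublinear_def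
proof safe
  fix x y
  let ?I = "\<lambda>x. INF q\<in>C. q x"
  have low: "?I z \<le> q z" if "q \<in> C" for q z
    using that bdd by (rule cINF_lower[rotated])
  have "?I (x + y) \<le> q x + r y" if qr: "q \<in> C" "r \<in> C" for q r
  proof -
    consider "q \<le> r" | "r \<le> q" using tot qr by blast
    then show ?thesis
    proof cases
      case 1
      then have "q (x + y) \<le> q x + r y"
        using sub[OF qr(1)] unfolding sublinear_def le_fun_def
        by (metis add_left_mono order_trans)
      with low[OF qr(1), of "x + y"] show ?thesis by simp
    next
      case 2
      then have "r (x + y) \<le> q x + r y"
        using sub[OF qr(2)] unfolding sublinear_def le_fun_def
        by (metis add_right_mono order_trans)
      with low[OF qr(2), of "x + y"] show ?thesis by simp
    qed
  qed
  then have "?I (x + y) - q x \<le> r y" if "q \<in> C" "r \<in> C" for q r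
    using that by (simp add: algebra_simps)
  then have "?I (x + y) - q x \<le> ?I y" if "q \<in> C" for q
    using that by (intro cINF_greatest assms)
  then have "?I (x + y) - ?I y \<le> q x" if "q \<in> C" for q
    using that by (simp add: algebra_simps)
  then have "?I (x + y) - ?I y \<le> ?I x"
    by (intro cINF_greatest assms)
  then show "?I (x + y) \<le> ?I x + ?I y" by simp
next
  let ?I = "\<lambda>x. INF q\<in>C. q x"
  have half: "?I (c *\<^sub>R x) \<le> c * ?I x" if c: "0 < c" for c x
  proof -
    have "?I (c *\<^sub>R x) / c \<le> ?I x"
    proof (rule cINF_greatest[OF assms(1)])
      fix q assume "q \<in> C"
      have "?I (c *\<^sub>R x) \<le> q (c *\<^sub>R x)" using \<open>q \<in> C\<close> bdd by (rule cINF_lower[rotated])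
      also have "\<dots> = c * q x" using sub[OF \<open>q \<in> C\<close>] c by (simp add: sublinear_def)
      finally show "?I (c *\<^sub>R x) / c \<le> q x" using c by (simp add: field_simps)
    qed
    then show ?thesis using c by (simp add: field_simps)
  qed
  fix c :: real and x
  assume c: "0 < c"
  have "?I ((1 / c) *\<^sub>R (c *\<^sub>R x)) \<le> (1 / c) * ?I (c *\<^sub>R x)"
    by (rule half) (use c in auto)
  then have "c * ?I x \<le> ?I (c *\<^sub>R x)" using c by (simp add: field_simps)
  with half[OF c, of x] show "?I (c *\<^sub>R x) = c * ?I x" by simp
qed

text \<open>Hahn--Banach: a minimal sublinear functional is linear, since it is not lowered by any shift.\<close>

lemma sublinear_dominates_linear:
  fixes p :: "'a::real_vector \<Rightarrow> real"
  assumes p: "sublinear p"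
  obtains f where "linear f" "f \<le> p"
proof -
  let ?A = "{q. sublinear q \<and> q \<le> p}"
  have lower: "- p (- x) \<le> q x" if "q \<in> ?A" for q x
  proof -
    have "q (x + - x) \<le> q x + q (- x)" using that unfolding sublinear_def by blast
    moreover have "q 0 = 0" using that sublinear_zero by blast
    moreover have "q (- x) \<le> p (- x)" using that by (simp add: le_fun_def)
    ultimately show ?thesis by simp
  qed
  have "\<exists>m\<in>?A. \<forall>q\<in>?A. q \<le> m \<longrightarrow> q = m"
  proof (rule predicate_Zorn)
    \<comment> \<open>The order is reversed, so that a maximal element is a minimal
      functional.\<close>
    show "partial_order_on ?A (relation_of (\<lambda>x y. y \<le> x) ?A)"
      by (rule partial_order_on_relation_ofI) auto
  next
    fix C assume "C \<in> Chains (relation_of (\<lambda>x y. y \<le> x) ?A)"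
    then have CA: "C \<subseteq> ?A" and tot: "\<And>q r. q \<in> C \<Longrightarrow> r \<in> C \<Longrightarrow> q \<le> r \<or> r \<le> q"
      unfolding Chains_def relation_of_def by blast+
    show "\<exists>u\<in>?A. \<forall>q\<in>C. u \<le> q"
    proof (cases "C = {}")
      case True
      then show ?thesis using p by auto
    next
      case False
      let ?I = "\<lambda>x. INF q\<in>C. q x"
      have bdd: "bdd_below ((\<lambda>q. q x) ` C)" for x
        using lower CA by (intro bdd_belowI2[where m="- p (- x)"]) blast
      have le: "?I \<le> q" if "q \<in> C" for q
        using that bdd by (auto simp: le_fun_def intro: cINF_lower)
      have "sublinear ?I"
        using False CA tot bdd by (intro sublinear_INF_chain) blast+
      moreover have "?I \<le> p" using False le CA by (metis (no_types,
          lifting) all_not_in_conv mem_Collect_eq order_trans subsetD)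
      ultimately show ?thesis using le by blast
    qed
  qed
  then obtain f where f: "sublinear f" "f \<le> p"
    and min: "\<And>q. sublinear q \<Longrightarrow> q \<le> p \<Longrightarrow> q \<le> f \<Longrightarrow> q = f" by blast
  have "sublinear_shift f a = f" for a
    using f by (intro min sublinear_sublinear_shift order_trans[OF sublinear_shift_le_self]
        sublinear_shift_le_self)
  \<comment> \<open>The shift at \<open>t = 1\<close> gives the reverse of subadditivity.\<close>
  then have "f x \<le> f (x + a) - f a" for a x
    using sublinear_shift_le[OF f(1), of 1 a x] by simp
  then have add: "f (x + a) = f x + f a" for a x
    using f(1) unfolding sublinear_def by (smt (verit))
  have minus: "f (- x) = - f x" for x
    using add[of x "- x"] sublinear_zero[OF f(1)] by simp
  have "f (c *\<^sub>R x) = c *\<^sub>R f x" for c x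
  proof (cases "0 \<le> c")
    case False
    then have "f (c *\<^sub>R x) = - f ((- c) *\<^sub>R x)" by (simp add: minus)
    with False show ?thesis using sublinear_scaleR_nonneg[OF f(1), of "- c" x] by simp
  qed (simp add: sublinear_scaleR_nonneg f)
  then have "linear f" using add by (intro linearI)
  then show thesis using f(2) that by blast
qed

text \<open>Hahn-Banach is applied not to the norm but to its shift at \<open>a\<close>: the
  dominated \<open>f\<close> then satisfies \<open>f (- a) \<le> - norm a\<close>, hence attains the
  norm at \<open>a\<close>, and no extension from a subspace is involved.\<close>

lemma norming_functional:
  fixes a :: "'a::real_normed_vector"
  obtains \<phi> :: "'a dual" where "norm \<phi> \<le> 1" "blinfun_apply \<phi> a = norm a"
proof -
  obtain f where f: "linear f" "f \<le> sublinear_shift norm a"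
    using sublinear_dominates_linear sublinear_sublinear_shift[OF sublinear_norm] by blast
  have le: "f x \<le> norm x" for x
    using f(2) sublinear_shift_le_self[OF sublinear_norm, of a] by (meson le_funD order_trans)
  have abs: "\<bar>f x\<bar> \<le> norm x" for x
    using le[of x] le[of "- x"] linear_neg[OF f(1), of x] by simp
  have "f (- a) \<le> - norm a"
    using le_funD[OF f(2), of "- a"] sublinear_shift_le[OF sublinear_norm, of 1 a "- a"] by simp
  then have "f a = norm a"
    using le[of a] linear_neg[OF f(1), of a] by simp
  moreover have bl: "bounded_linear f"
    using f(1) abs by (intro bounded_linear_intro[where K=1])
      (auto simp: linear_add linear_cmul)
  moreover have "norm (Blinfun f) \<le> 1"
    by (rule norm_blinfun_bound) (use abs in \<open>auto simp: bounded_linear_Blinfun_apply[OF bl]\<close>)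
  ultimately show thesis
    using that[of "Blinfun f"] by (simp add: bounded_linear_Blinfun_apply)
qed

lemma norm_canonical_embedding [simp]: "norm (blinfun_apply canonical_embedding a) = norm a"
proof (rule antisym)
  show "norm (blinfun_apply canonical_embedding a) \<le> norm a"
    by (rule norm_blinfun_bound) (auto simp: mult.commute[of "norm a"] norm_blinfun simp flip:
        real_norm_def)
  obtain \<phi> :: "'a dual" where \<phi>: "norm \<phi> \<le> 1" "blinfun_apply \<phi> a = norm a"
    using norming_functional by blast
  have "norm a = norm (blinfun_apply (blinfun_apply canonical_embedding a) \<phi>)"
    by (simp add: \<phi>)
  also have "\<dots> \<le> norm (blinfun_apply canonical_embedding a) * norm \<phi>"
    by (rule norm_blinfun)
  also have "\<dots> \<le> norm (blinfun_apply canonical_embedding a) * 1"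
    using \<phi>(1) by (intro mult_left_mono) auto
  finally show "norm a \<le> norm (blinfun_apply canonical_embedding a)" by simp
qed

lemma inj_canonical_embedding: "inj (blinfun_apply canonical_embedding)"
  by (intro injI) (metis (no_types) blinfun.diff_right norm_canonical_embedding norm_eq_zero
      right_minus_eq)

section \<open>Uniform boundedness by a gliding hump\<close>

lemma blinfun_norm_attained_approx:
  fixes f :: "'a::real_normed_vector \<Rightarrow>\<^sub>L 'b::real_normed_vector"
  assumes "c < norm f"
  obtains x where "norm x \<le> 1" "c < norm (blinfun_apply f x)"
proof (cases "c < 0")
  case True
  then show thesis using that[of 0] by simp
next
  case False
  then have "\<not> (\<forall>x. norm (blinfun_apply f x) \<le> c * norm x)"
    using norm_blinfun_bound[of c f] assms by auto
  then obtain x where x: "c * norm x < norm (blinfun_apply f x)" by (auto simp: not_le)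
  then have "norm x > 0" by auto
  with x have "c < norm (blinfun_apply f ((1 / norm x) *\<^sub>R x))"
    by (simp add: blinfun.scaleR_right field_simps)
  then show thesis using that[of "(1 / norm x) *\<^sub>R x"] \<open>norm x > 0\<close> by simp
qed

text \<open>One of the two points \<open>x \<plusminus> u\<close> is moved at least as far as \<open>u\<close> itself; this drives the
  gliding-hump proof of uniform boundedness, which needs no Baire category argument.\<close>

lemma blinfun_perturbation:
  fixes f :: "'a::real_normed_vector \<Rightarrow>\<^sub>L 'b::real_normed_vector"
  assumes "0 < r" "f \<noteq> 0"
  obtains y where "dist y x \<le> r" "norm f * r / 2 < norm (blinfun_apply f y)"
proof -
  have "norm f / 2 < norm f" using assms by simp
  then obtain u where u: "norm u \<le> 1" "norm f / 2 < norm (blinfun_apply f u)"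
    using blinfun_norm_attained_approx by blast
  let ?v = "r *\<^sub>R u"
  have "2 * norm (blinfun_apply f ?v) = norm (blinfun_apply f (x + ?v) - blinfun_apply f (x - ?v))"
    by (simp add: blinfun.add_right blinfun.diff_right algebra_simps flip: scaleR_2)
  also have "\<dots> \<le> norm (blinfun_apply f (x + ?v)) + norm (blinfun_apply f (x - ?v))"
    by (rule norm_triangle_ineq4)
  finally have "norm (blinfun_apply f ?v) \<le> norm (blinfun_apply f (x + ?v)) \<or>
      norm (blinfun_apply f ?v) \<le> norm (blinfun_apply f (x - ?v))" by linarith
  moreover have "norm f * r / 2 < norm (blinfun_apply f ?v)"
    using u(2) assms(1) by (simp add: blinfun.scaleR_right field_simps)
  moreover have "dist (x + ?v) x \<le> r" "dist (x - ?v) x \<le> r"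
    using u(1) assms(1) by (auto simp: dist_norm mult_left_le)
  ultimately show thesis using that by fastforce
qed

theorem uniform_boundedness:
  fixes f :: "nat \<Rightarrow> 'a::banach \<Rightarrow>\<^sub>L 'b::real_normed_vector"
  assumes pt: "\<And>x. bounded (range (\<lambda>n. blinfun_apply (f n) x))"
  shows "bounded (range f)"
proof (rule ccontr)
  assume "\<not> bounded (range f)"
  then have large: "\<exists>n. c < norm (f n)" for c
    by (metis (mono_tags, lifting) boundedI imageE linorder_not_le)
  \<comment> \<open>Move \<open>k\<close> has length at most \<open>(1/4)^k\<close> and reaches more
    than \<open>1/2\<close> of \<open>norm (f (N k)) * (1/4)^k\<close>; all later moves together
    have length at most \<open>1/3 * (1/4)^k\<close>. At the limit \<open>1/2 - 1/3 = 1/6\<close> of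
    that product survives, and the factor \<open>8\<close> exceeds \<open>6\<close>.\<close>
  define N where "N k = (SOME n. 8 * 4 ^ k * real (Suc k) < norm (f n))" for k :: nat
  have N: "8 * 4 ^ k * real (Suc k) < norm (f (N k))" for k
    unfolding N_def using large by (rule someI_ex)
  have "\<exists>s. \<forall>k. True \<and> (dist (s (Suc k)) (s k) \<le> (1/4)^k \<and>
      norm (f (N k)) * (1/4)^k / 2 < norm (blinfun_apply (f (N k)) (s (Suc k))))"
  proof (rule dependent_nat_choice[where P="\<lambda>_ _. True"])
    fix x :: 'a and k :: nat
    have "f (N k) \<noteq> 0" using N[of k] by (smt (verit) norm_zero mult_nonneg_nonneg of_nat_0_le_iff
        zero_le_power)
    then show "\<exists>y. True \<and> dist y x \<le> (1/4)^k \<and>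
      norm (f (N k)) * (1/4)^k / 2 < norm (blinfun_apply (f (N k)) y)"
      using blinfun_perturbation[of "(1/4)^k" "f (N k)" x]
          by (metis zero_less_power zero_less_divide_1_iff zero_less_numeral)
  qed auto
  then obtain s where s: "\<And>k. dist (s (Suc k)) (s k) \<le> (1/4)^k"
    and big: "\<And>k. norm (f (N k)) * (1/4)^k / 2 < norm (blinfun_apply (f (N k)) (s (Suc k)))"
    by blast
  \<comment> \<open>The exact geometric sum, with its remainder subtracted, is what the induction on
    \<open>j\<close> can carry; \<open>tail'\<close> drops the remainder.\<close>
  have tail: "dist (s (k + j)) (s k) \<le> 4/3 * (1/4)^k - 4/3 * (1/4)^(k+j)" for k j
  proof (induction j)
    case (Suc j)
    have "dist (s (k + Suc j)) (s k) \<le> dist (s (Suc (k + j))) (s (k + j)) + dist (s (k + j)) (s k)"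
      using dist_triangle by simp
    with s[of "k + j"] Suc show ?case by simp
  qed simp
  have tail': "dist (s m) (s k) \<le> 4/3 * (1/4)^k" if "k \<le> m" for k m
  proof -
    from le_Suc_ex[OF that] obtain j where j: "m = k + j" ..
    have "0 \<le> 4/3 * (1/4 :: real) ^ (k + j)" by (intro mult_nonneg_nonneg zero_le_power) auto
    moreover have "a \<le> b - c \<Longrightarrow> 0 \<le> c \<Longrightarrow> a \<le> b" for a b c :: real by simp
    ultimately show ?thesis using tail[of k j] unfolding j by blast
  qed
  have "Cauchy s"
  proof (rule metric_CauchyI)
    fix e :: real assume "0 < e"
    then obtain k where k: "(1/4)^k < e / 4"
      using real_arch_pow_inv[of "e/4" "1/4"] by auto
    have "dist (s m) (s n) < e" if "m \<ge> k" "n \<ge> k" for m n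
      using dist_triangle2[of "s m" "s n" "s k"] tail'[OF that(1)] tail'[OF that(2)] k \<open>0 < e\<close>
          by linarith
    then show "\<exists>M. \<forall>m\<ge>M. \<forall>n\<ge>M. dist (s m) (s n) < e" by blast
  qed
  then obtain x where x: "s \<longlonglongrightarrow> x" using Cauchy_convergent_iff convergent_def by blast
  have close: "dist x (s k) \<le> 4/3 * (1/4)^k" for k
    by (rule LIMSEQ_le_const2[OF tendsto_dist[OF x tendsto_const]]) (use tail' in blast)
  have unb: "real (Suc k) / 1 \<le> norm (blinfun_apply (f (N k)) x)" for k
  proof -
    have "norm (blinfun_apply (f (N k)) (s (Suc k))) - norm (blinfun_apply (f (N k)) x) \<le>
        norm (blinfun_apply (f (N k)) (x - s (Suc k)))"
      by (simp add: blinfun.diff_right norm_triangle_ineq2 norm_minus_commute[of "blinfun_apply (f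
          (N k)) x"])
    also have "\<dots> \<le> norm (f (N k)) * norm (x - s (Suc k))" by (rule norm_blinfun)
    also have "\<dots> \<le> norm (f (N k)) * (1/3 * (1/4)^k)"
      using close[of "Suc k"] by (intro mult_left_mono) (auto simp: dist_norm)
    finally have "norm (f (N k)) * (1/4)^k / 6 \<le> norm (blinfun_apply (f (N k)) x)"
      using big[of k] by simp
    moreover have "8 * real (Suc k) \<le> norm (f (N k)) * (1/4)^k"
      using N[of k] by (simp add: field_simps)
    ultimately show ?thesis by linarith
  qed
  obtain B where "\<And>n. norm (blinfun_apply (f n) x) \<le> B"
    using pt[of x] unfolding bounded_iff by auto
  then have "real (Suc k) \<le> B" for k using unb[of k] by (metis div_by_1 order_trans)
  moreover obtain k where "B < real k" using reals_Archimedean2 by blast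
  ultimately show False by (smt (verit) of_nat_Suc)
qed

section \<open>Boundedness and images of null and summable sequences\<close>

lemma weak_star_null_bounded:
  fixes \<psi> :: "nat \<Rightarrow> 'a::banach dual"
  assumes "weak_star_null \<psi>"
  shows "bounded (range \<psi>)"
  using assms unfolding weak_star_null_def
  by (intro uniform_boundedness convergent_imp_bounded) blast

text \<open>The sequence is viewed as functionals on \<open>'a dual\<close>, which is complete
  although \<open>'a\<close> itself need not be; the isometric embedding brings the bound
  back.\<close>

lemma weakly_null_bounded:
  fixes x :: "nat \<Rightarrow> 'a::real_normed_vector"
  assumes "weakly_null x"
  shows "bounded (range x)"
proof -
  have "weak_star_null (\<lambda>n. blinfun_apply canonical_embedding (x n))"
    using assms by (simp add: weak_star_null_def weakly_null_def)
  then have "bounded (range (\<lambda>n. blinfun_apply canonical_embedding (x n)))"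
    by (rule weak_star_null_bounded)
  then show ?thesis by (simp add: bounded_iff)
qed

lemma weakly_p_summable_imp_weakly_null:
  assumes "0 < p" "weakly_p_summable p x"
  shows "weakly_null x"
  unfolding weakly_null_def
proof
  fix \<phi> :: "'a dual"
  have "(\<lambda>n. \<bar>blinfun_apply \<phi> (x n)\<bar> powr p) \<longlonglongrightarrow> 0"
    using assms(2) unfolding weakly_p_summable_def by (intro summable_LIMSEQ_zero) blast
  then have "(\<lambda>n. (\<bar>blinfun_apply \<phi> (x n)\<bar> powr p) powr (1 / p)) \<longlonglongrightarrow> 0 powr (1 / p)"
    using assms(1) by (intro tendsto_powr') auto
  then show "(\<lambda>n. blinfun_apply \<phi> (x n)) \<longlonglongrightarrow> 0"
    using assms(1) by (simp add: powr_powr tendsto_rabs_zero_iff)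
qed

lemma weakly_null_image:
  fixes L :: "'a::real_normed_vector \<Rightarrow>\<^sub>L 'b::real_normed_vector"
  shows "weakly_null x \<Longrightarrow> weakly_null (\<lambda>n. blinfun_apply L (x n))"
  unfolding weakly_null_def
proof
  fix \<phi> :: "'b dual"
  assume "\<forall>\<phi> :: 'a dual. (\<lambda>n. blinfun_apply \<phi> (x n)) \<longlonglongrightarrow> 0"
  from this[THEN spec, of "\<phi> o\<^sub>L L"]
  show "(\<lambda>n. blinfun_apply \<phi> (blinfun_apply L (x n))) \<longlonglongrightarrow> 0" by simp
qed

lemma weakly_p_summable_image:
  fixes L :: "'a::real_normed_vector \<Rightarrow>\<^sub>L 'b::real_normed_vector"
  shows "weakly_p_summable p x \<Longrightarrow> weakly_p_summable p (\<lambda>n. blinfun_apply L (x n))"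
  unfolding weakly_p_summable_def
proof
  fix \<phi> :: "'b dual"
  assume "\<forall>\<phi> :: 'a dual. summable (\<lambda>n. \<bar>blinfun_apply \<phi> (x n)\<bar> powr p)"
  from this[THEN spec, of "\<phi> o\<^sub>L L"]
  show "summable (\<lambda>n. \<bar>blinfun_apply \<phi> (blinfun_apply L (x n))\<bar> powr p)" by simp
qed

section \<open>Functionals on \<open>C(K,X)\<close> for dispersed \<open>K\<close>\<close>

lemma compact_imp_bcontfun:
  fixes f :: "'k::topological_space \<Rightarrow> 'b::metric_space"
  assumes "compact (UNIV :: 'k set)" "continuous_on UNIV f"
  shows "f \<in> bcontfun"
  using compact_imp_bounded[OF compact_continuous_image[OF assms(2,1)]] assms(2)
  by (simp add: bcontfun_def)

lemma compact_urysohn: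
  fixes A B :: "'k::t2_space set"
  assumes "compact (UNIV :: 'k set)" "closed A" "closed B" "A \<inter> B = {}"
  shows "\<exists>h :: 'k \<Rightarrow>\<^sub>C real. (\<forall>t. 0 \<le> apply_bcontfun h t) \<and> (\<forall>t. apply_bcontfun h t \<le> 1) \<and>
    (\<forall>t\<in>A. apply_bcontfun h t = 1) \<and> (\<forall>t\<in>B. apply_bcontfun h t = 0)"
proof -
  have "normal_space (euclidean :: 'k topology)"
    using assms(1) hausdorff
    by (intro compact_Hausdorff_or_regular_imp_normal_space disjI1)
      (auto simp: compact_space_def Hausdorff_space_def disjnt_def)
  moreover have "disjnt B A" using assms(4) by (auto simp: disjnt_def)
  ultimately obtain h where h: "continuous_map euclidean (top_of_set {0..1::real}) h"
      "h ` B \<subseteq> {0}" "h ` A \<subseteq> {1}"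
    using Urysohn_lemma[of euclidean B A 0 1] assms(2,3) by (metis closed_closedin zero_le_one)
  then have h01: "continuous_on UNIV h" "\<And>t. 0 \<le> h t" "\<And>t. h t \<le> 1"
    by (auto simp: continuous_map_in_subtopology Pi_iff image_subset_iff)
  then have "apply_bcontfun (Bcontfun h) = h"
    by (intro Bcontfun_inverse compact_imp_bcontfun[OF assms(1)])
  then show ?thesis using h h01 by (intro exI[of _ "Bcontfun h"]) auto
qed

definition bcontfun_scale ::
    "('k::topological_space \<Rightarrow>\<^sub>C real) \<Rightarrow> ('k \<Rightarrow>\<^sub>C 'x::real_normed_vector) \<Rightarrow> ('k \<Rightarrow>\<^sub>C 'x)"
  where "bcontfun_scale h f = Bcontfun (\<lambda>t. h t *\<^sub>R f t)"

lemma bcontfun_scale_apply [simp]: "bcontfun_scale h f t = h t *\<^sub>R f t"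
proof -
  have "norm (h t *\<^sub>R f t) \<le> norm h * norm f" for t
    unfolding norm_scaleR real_norm_def[symmetric] by (intro mult_mono norm_bounded) auto
  then have "(\<lambda>t. h t *\<^sub>R f t) \<in> bcontfun"
    by (intro bcontfun_normI continuous_intros) auto
  then show ?thesis by (simp add: bcontfun_scale_def Bcontfun_inverse)
qed

lemma norm_bcontfun_scale_le:
  fixes h :: "'k::topological_space \<Rightarrow>\<^sub>C real" and f :: "'k \<Rightarrow>\<^sub>C 'x::real_normed_vector"
  assumes "\<And>t. 0 \<le> h t" "\<And>t. h t \<le> 1"
  shows "norm (bcontfun_scale h f) \<le> norm f"
proof (rule norm_bound)
  fix t
  have "\<bar>h t\<bar> * norm (f t) \<le> 1 * norm f"
    using assms by (intro mult_mono norm_bounded) (auto simp: abs_le_iff)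
  then show "norm (bcontfun_scale h f t) \<le> norm f" by simp
qed

text \<open>The radial retraction onto the ball of radius \<open>c\<close>. It splits
  \<open>f\<close> into a uniformly small \<open>g\<close> and a remainder \<open>f - g\<close> that
  vanishes where \<open>norm (f t) \<le> c\<close>, hence lives on a closed set inside any open set
  off which \<open>f\<close> vanishes.\<close>

lemma radial_clamp:
  fixes f :: "'k::topological_space \<Rightarrow>\<^sub>C 'x::real_normed_vector"
  assumes c: "0 < c"
  obtains g :: "'k \<Rightarrow>\<^sub>C 'x" where "\<And>t. norm (g t) \<le> c" "\<And>t. norm (f t) \<le> c \<Longrightarrow> g t = f t"
    "\<And>t. norm (f t - g t) \<le> norm (f t)"
proof -
  let ?g = "\<lambda>t. (c / max c (norm (f t))) *\<^sub>R f t"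
  have le: "norm (?g t) \<le> c" for t
    using c by (auto simp: max_def field_simps)
  have "?g \<in> bcontfun"
    using c le by (intro bcontfun_normI[where b=c] continuous_intros) auto
  then have "apply_bcontfun (Bcontfun ?g) = ?g" by (simp add: Bcontfun_inverse)
  moreover have "norm (f t - ?g t) \<le> norm (f t)" for t
  proof -
    have "f t - ?g t = (1 - c / max c (norm (f t))) *\<^sub>R f t" by (simp add: algebra_simps)
    moreover have "0 \<le> c / max c (norm (f t))" "c / max c (norm (f t)) \<le> 1"
      using c by (auto intro!: divide_nonneg_pos divide_le_eq_1_pos[THEN iffD2] simp:
          less_max_iff_disj)
    then have "\<bar>1 - c / max c (norm (f t))\<bar> \<le> 1" by linarith
    ultimately show ?thesis by (simp only: norm_scaleR mult_left_le_one_le norm_ge_zero abs_ge_zero)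
  qed
  moreover have "?g t = f t" if "norm (f t) \<le> c" for t
    using that c by (simp add: max_def)
  ultimately show thesis using that[of "Bcontfun ?g"] le by simp
qed

text \<open>The functions need only vanish off \<open>W\<close> and may have support reaching its
  boundary; this is why gluing two open sets requires truncation.\<close>

definition atomic_on ::
    "('k::topological_space \<Rightarrow>\<^sub>C 'x::real_normed_vector) dual \<Rightarrow> 'k set \<Rightarrow> bool"
  where "atomic_on \<phi> W \<longleftrightarrow> (\<forall>\<epsilon>>0. \<exists>F. finite F \<and>
    (\<forall>f. (\<forall>t\<in>F. apply_bcontfun f t = 0) \<and> (\<forall>t. t \<notin> W \<longrightarrow> f t = 0) \<longrightarrow> \<bar>blinfun_apply \<phi> f\<bar> \<le>
        \<epsilon> * norm f))"

section \<open>Gluing open sets on which a functional is atomic\<close>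

lemma atomic_on_empty: "atomic_on \<phi> {}"
proof -
  have "f = 0" if "\<forall>t. f t = 0" for f :: "'a \<Rightarrow>\<^sub>C 'b"
    using that by (intro bcontfun_eqI) simp
  then have "\<bar>blinfun_apply \<phi> f\<bar> \<le> \<epsilon> * norm f" if "\<forall>t. apply_bcontfun f t = 0" for f \<epsilon>
    using that by (metis abs_zero blinfun.zero_right mult_zero_right norm_zero order_refl)
  then show ?thesis unfolding atomic_on_def by (auto intro!: exI[of _ "{}"])
qed

lemma functional_le: "norm f \<le> c \<Longrightarrow> \<bar>blinfun_apply \<phi> f\<bar> \<le> norm \<phi> * c"
  using norm_blinfun[of \<phi> f] mult_left_mono[of "norm f" c "norm \<phi>"] by simp

text \<open>Cut \<open>f\<close> into a part vanishing off \<open>G\<close>, a part vanishing off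
  \<open>H\<close> and a clamped part of norm at most \<open>d\<close>; each contributes at most
  \<open>\<epsilon>/3 * norm f\<close>.\<close>

lemma atomic_on_Un:
  fixes \<phi> :: "('k::t2_space \<Rightarrow>\<^sub>C 'x::real_normed_vector) dual"
  assumes K: "compact (UNIV :: 'k set)"
    and "open G" "open H" and G: "atomic_on \<phi> G" and H: "atomic_on \<phi> H"
  shows "atomic_on \<phi> (G \<union> H)"
  unfolding atomic_on_def
proof (intro allI impI)
  fix \<epsilon> :: real assume "0 < \<epsilon>"
  then have e3: "0 < \<epsilon> / 3" by simp
  from G e3 obtain E where E: "finite E" "\<And>f. (\<forall>t\<in>E. apply_bcontfun f t = 0) \<Longrightarrow> (\<forall>t. t \<notin> G \<longrightarrow> f t =
      0) \<Longrightarrow> \<bar>blinfun_apply \<phi> f\<bar> \<le> \<epsilon>/3 * norm f"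
    unfolding atomic_on_def by meson
  from H e3 obtain F where F: "finite F" "\<And>f. (\<forall>t\<in>F. apply_bcontfun f t = 0) \<Longrightarrow> (\<forall>t. t \<notin> H \<longrightarrow> f t =
      0) \<Longrightarrow> \<bar>blinfun_apply \<phi> f\<bar> \<le> \<epsilon>/3 * norm f"
    unfolding atomic_on_def by meson
  have "\<bar>blinfun_apply \<phi> f\<bar> \<le> \<epsilon> * norm f"
    if f0: "\<forall>t\<in>E \<union> F. f t = 0" "\<forall>t. t \<notin> G \<union> H \<longrightarrow> f t = 0" for f :: "'k \<Rightarrow>\<^sub>C 'x"
  proof (cases "f = 0")
    case False
    \<comment> \<open>Chosen so that \<open>norm \<phi> * d\<close> stays within the third allotted
      to the clamped part; the \<open>+ 1\<close> guards against \<open>\<phi> = 0\<close>.\<close>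
    define d where "d = \<epsilon> * norm f / (3 * (norm \<phi> + 1))"
    have n1: "0 < norm \<phi> + 1" by (simp add: add_nonneg_pos)
    have d: "0 < d" unfolding d_def using False \<open>0 < \<epsilon>\<close> n1 by simp
    obtain g where g: "\<And>t. norm (apply_bcontfun g t) \<le> d" "\<And>t. norm (f t) \<le> d \<Longrightarrow> g t = f t"
        "\<And>t. norm (f t - g t) \<le> norm (f t)"
      using radial_clamp[OF d, of f] by blast
    \<comment> \<open>\<open>f - g\<close> vanishes off \<open>?L\<close>, and \<open>?L - H\<close>
      is closed and contained in \<open>G\<close>. With \<open>h = 1\<close> there and
      \<open>h = 0\<close> off \<open>G\<close>, the part \<open>h (f - g)\<close> vanishes off
      \<open>G\<close> and the rest vanishes off \<open>H\<close>.\<close>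
    let ?L = "{t. d \<le> norm (f t)}"
    have "closed ?L" by (intro closed_Collect_le continuous_intros) auto
    then have cl: "closed (?L - H)" "closed (- G)" using assms by auto
    have "?L \<subseteq> G \<union> H" using f0(2) d by force
    then have "(?L - H) \<inter> - G = {}" by blast
    from compact_urysohn[OF K cl this] obtain h :: "'k \<Rightarrow>\<^sub>C real" where h: "\<forall>t. 0 \<le>
        apply_bcontfun h t"
      "\<forall>t. h t \<le> 1" "\<forall>t\<in>?L - H. h t = 1" "\<forall>t\<in>- G. h t = 0"
      by (elim exE conjE)
    let ?f1 = "bcontfun_scale h (f - g)" and ?f2 = "bcontfun_scale (const_bcontfun 1 - h) (f - g)"
    have n: "norm (f - g) \<le> norm f"
      using order_trans[OF g(3) norm_bounded] by (intro norm_bound) simp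
    have g0: "g t = 0" if "f t = 0" for t using g(2)[of t] that d by simp
    have "\<bar>blinfun_apply \<phi> ?f1\<bar> \<le> \<epsilon>/3 * norm ?f1"
      by (rule E(2)) (use f0 g0 h in \<open>auto simp: bcontfun_scale_apply\<close>)
    also have "\<dots> \<le> \<epsilon>/3 * norm f"
      using \<open>0 < \<epsilon>\<close> norm_bcontfun_scale_le[of h "f - g"] h n by (intro mult_left_mono) auto
    finally have 1: "\<bar>blinfun_apply \<phi> ?f1\<bar> \<le> \<epsilon>/3 * norm f" .
    have "\<bar>blinfun_apply \<phi> ?f2\<bar> \<le> \<epsilon>/3 * norm ?f2"
    proof (rule F(2))
      show "\<forall>t. t \<notin> H \<longrightarrow> ?f2 t = 0"
      proof (intro allI impI)
        fix t assume "t \<notin> H"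
        then show "?f2 t = 0" using h(3) g(2)[of t]
          by (cases "d \<le> norm (f t)") (auto simp: bcontfun_scale_apply const_bcontfun.rep_eq)
      qed
    qed (use f0 g0 in \<open>auto simp: bcontfun_scale_apply\<close>)
    also have "\<dots> \<le> \<epsilon>/3 * norm f"
      using \<open>0 < \<epsilon>\<close> norm_bcontfun_scale_le[of "const_bcontfun 1 - h" "f - g"] h n
      by (intro mult_left_mono) (auto simp: const_bcontfun.rep_eq)
    finally have 2: "\<bar>blinfun_apply \<phi> ?f2\<bar> \<le> \<epsilon>/3 * norm f" .
    have "norm g \<le> d" using g(1) by (rule norm_bound)
    then have "\<bar>blinfun_apply \<phi> g\<bar> \<le> norm \<phi> * d" by (rule functional_le)
    also have "\<dots> \<le> (norm \<phi> + 1) * d" using d by simp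
    also have "\<dots> = \<epsilon>/3 * norm f" unfolding d_def using n1 by (simp add: field_simps)
    finally have 3: "\<bar>blinfun_apply \<phi> g\<bar> \<le> \<epsilon>/3 * norm f" .
    have "f = ?f1 + ?f2 + g"
      by (rule bcontfun_eqI) (simp add: bcontfun_scale_apply const_bcontfun.rep_eq algebra_simps)
    then have "blinfun_apply \<phi> f = blinfun_apply \<phi> ?f1 + blinfun_apply \<phi> ?f2 + blinfun_apply \<phi> g"
      by (metis blinfun.add_right)
    with 1 2 3 show ?thesis by (simp add: field_simps)
  qed (simp add: blinfun.zero_right)
  then show "\<exists>F. finite F \<and>
      (\<forall>f. (\<forall>t\<in>F. apply_bcontfun f t = 0) \<and> (\<forall>t. t \<notin> G \<union> H \<longrightarrow> f t = 0) \<longrightarrow> \<bar>blinfun_apply \<phi> f\<bar> \<le>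
          \<epsilon> * norm f)"
    using E(1) F(1) by (intro exI[of _ "E \<union> F"]) blast
qed

lemma atomic_on_finite_Union:
  fixes \<phi> :: "('k::t2_space \<Rightarrow>\<^sub>C 'x::real_normed_vector) dual"
  assumes K: "compact (UNIV :: 'k set)" and "finite D" "\<And>G. G \<in> D \<Longrightarrow> open G \<and> atomic_on \<phi> G"
  shows "atomic_on \<phi> (\<Union>D)"
  using assms(2,3)
proof (induction D rule: finite_induct)
  case (insert G D)
  then show ?case using atomic_on_Un[OF K, of G "\<Union>D" \<phi>] by (simp add: open_Union)
qed (simp add: atomic_on_empty)

text \<open>The functional nearly attains its norm over \<open>\<Union>D\<close> on some \<open>f\<^sub>0\<close> living on a compact
  \<open>L \<subseteq> \<Union>D\<close>; away from \<open>L\<close> it is then small, since anything it captured there could be added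
  to \<open>f\<^sub>0\<close> without increasing the norm. So only a finite subcover of \<open>L\<close> matters.\<close>

lemma atomic_on_Union:
  fixes \<phi> :: "('k::t2_space \<Rightarrow>\<^sub>C 'x::real_normed_vector) dual"
  assumes K: "compact (UNIV :: 'k set)" and D: "\<And>G. G \<in> D \<Longrightarrow> open G \<and> atomic_on \<phi> G"
  shows "atomic_on \<phi> (\<Union>D)"
  unfolding atomic_on_def
proof (intro allI impI)
  fix \<epsilon> :: real assume e: "0 < \<epsilon>"
  let ?B = "{f :: 'k \<Rightarrow>\<^sub>C 'x. norm f \<le> 1 \<and> (\<forall>t. t \<notin> \<Union>D \<longrightarrow> apply_bcontfun f t = 0)}"
  define N where "N = (SUP f\<in>?B. blinfun_apply \<phi> f)"
  have bdd: "bdd_above (blinfun_apply \<phi> ` ?B)"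
  proof (rule bdd_aboveI2)
    fix f assume "f \<in> ?B"
    then show "blinfun_apply \<phi> f \<le> norm \<phi> * 1" using functional_le[of f 1 \<phi>] by simp
  qed
  have upper: "blinfun_apply \<phi> f \<le> N" if "f \<in> ?B" for f
    unfolding N_def using that bdd by (rule cSUP_upper)
  have "?B \<noteq> {}" by (auto intro!: exI[of _ 0])
  then have "\<exists>f\<in>?B. N - \<epsilon>/4 < blinfun_apply \<phi> f"
    using less_cSUP_iff[OF _ bdd, of "N - \<epsilon>/4"] e by (simp add: N_def)
  then obtain f where f: "norm f \<le> 1" "\<And>t. t \<notin> \<Union>D \<Longrightarrow> apply_bcontfun f t = 0" "N -
      \<epsilon>/4 < blinfun_apply \<phi> f"
    by blast
  \<comment> \<open>Of the loss \<open>\<epsilon>/2\<close> in \<open>fg\<close>, one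
    \<open>\<epsilon>/4\<close> comes from not attaining the supremum and the other from clamping
    \<open>f\<close>.\<close>
  define d where "d = \<epsilon> / (4 * (norm \<phi> + 1))"
  have n1: "0 < norm \<phi> + 1" by (simp add: add_nonneg_pos)
  have d: "0 < d" unfolding d_def using e n1 by simp
  obtain g where g: "\<And>t. norm (apply_bcontfun g t) \<le> d" "\<And>t. norm (f t) \<le> d \<Longrightarrow> g t = f t"
      "\<And>t. norm (f t - g t) \<le> norm (f t)"
    using radial_clamp[OF d, of f] by blast
  have "norm g \<le> d" using g(1) by (rule norm_bound)
  then have "\<bar>blinfun_apply \<phi> g\<bar> \<le> norm \<phi> * d" by (rule functional_le)
  also have "\<dots> \<le> (norm \<phi> + 1) * d" using d by simp
  also have "\<dots> = \<epsilon>/4" unfolding d_def using n1 by (simp add: field_simps)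
  finally have fg: "N - \<epsilon>/2 < blinfun_apply \<phi> (f - g)"
    using f(3) by (simp add: blinfun.diff_right)
  let ?L = "{t. d \<le> norm (f t)}"
  have "closed ?L" by (intro closed_Collect_le continuous_intros) auto
  then have "compact ?L" using K by (metis compact_Int_closed Int_UNIV_left)
  moreover have "?L \<subseteq> \<Union>D" using f(2) d by force
  ultimately obtain D' where D': "D' \<subseteq> D" "finite D'" "?L \<subseteq> \<Union>D'"
    using D by (meson compactE)
  have "open (\<Union>D')" using D' D by blast
  then have "closed (- \<Union>D')" "?L \<inter> - \<Union>D' = {}" using D'(3) by auto
  from compact_urysohn[OF K \<open>closed ?L\<close> this] obtain h :: "'k \<Rightarrow>\<^sub>C real" where h: "\<forall>t. 0 \<le>
      apply_bcontfun h t"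
      "\<forall>t. h t \<le> 1" "\<forall>t\<in>?L. h t = 1" "\<forall>t\<in>- \<Union>D'. h t = 0"
    by (elim exE conjE)
  have "atomic_on \<phi> (\<Union>D')" using D' D by (intro atomic_on_finite_Union[OF K]) auto
  moreover have "0 < \<epsilon>/2" using e by simp
  ultimately obtain F where F: "finite F"
    "\<And>f. (\<forall>t\<in>F. apply_bcontfun f t = 0) \<Longrightarrow> (\<forall>t. t \<notin> \<Union>D' \<longrightarrow> f t = 0) \<Longrightarrow> \<bar>blinfun_apply \<phi> f\<bar> \<le>
        \<epsilon>/2 * norm f"
    unfolding atomic_on_def by meson
  have unit: "\<bar>blinfun_apply \<phi> u\<bar> \<le> \<epsilon>"
    if u: "norm u \<le> 1" "\<forall>t\<in>F. u t = 0" "\<forall>t. t \<notin> \<Union>D \<longrightarrow> u t = 0" for u :: "'k \<Rightarrow>\<^sub>C 'x"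
  proof -
    let ?u1 = "bcontfun_scale h u" and ?u2 = "bcontfun_scale (const_bcontfun 1 - h) u"
    have nu: "norm ?u1 \<le> 1" "norm ?u2 \<le> 1"
      using norm_bcontfun_scale_le[of h u] norm_bcontfun_scale_le[of "const_bcontfun 1 -
          h" u] h u(1)
      by (auto simp: const_bcontfun.rep_eq)
    have "\<bar>blinfun_apply \<phi> ?u1\<bar> \<le> \<epsilon>/2 * norm ?u1"
      by (rule F(2)) (use u h in \<open>auto simp: bcontfun_scale_apply\<close>)
    also have "\<dots> \<le> \<epsilon>/2" using nu e by (simp add: mult_left_le)
    finally have 1: "\<bar>blinfun_apply \<phi> ?u1\<bar> \<le> \<epsilon>/2" .
    have fgL: "f t - g t = 0" if "t \<notin> ?L" for t using g(2)[of t] that by simp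
    have u2L: "?u2 t = 0" if "t \<in> ?L" for t
      using h(3) that by (simp add: bcontfun_scale_apply const_bcontfun.rep_eq)
    have fg1: "norm (f t - g t) \<le> 1" for t
      using g(3)[of t] norm_bounded[of f t] f(1) by linarith
    \<comment> \<open>\<open>f - g\<close> lives on \<open>?L\<close> and \<open>?u2\<close> off it,
      so the norms do not add up. Both signs are kept in order to bound an absolute value.\<close>
    have n1: "norm ((f - g + ?u2) t) \<le> 1" "norm ((f - g - ?u2) t) \<le> 1" for t
      using fgL[of t] u2L[of t] fg1[of t] norm_bounded[of ?u2 t] nu(2)
      by (cases "t \<in> ?L", auto)+
    have "g t = 0 \<and> ?u2 t = 0" if "t \<notin> \<Union>D" for t
      using that f(2)[OF that] g(2)[of t] d u(3) by simp
    then have "f - g + ?u2 \<in> ?B" "f - g - ?u2 \<in> ?B"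
      using f(2) n1 by (auto intro!: norm_bound)
    from this[THEN upper] have "\<bar>blinfun_apply \<phi> ?u2\<bar> \<le> \<epsilon>/2"
      using fg by (simp add: blinfun.add_right blinfun.diff_right)
    moreover have "u = ?u1 + ?u2"
      by (rule bcontfun_eqI) (simp add: bcontfun_scale_apply const_bcontfun.rep_eq algebra_simps)
    then have "blinfun_apply \<phi> u = blinfun_apply \<phi> ?u1 + blinfun_apply \<phi> ?u2"
      by (metis blinfun.add_right)
    ultimately show ?thesis using 1 by linarith
  qed
  have "\<bar>blinfun_apply \<phi> u\<bar> \<le> \<epsilon> * norm u"
    if u: "\<forall>t\<in>F. u t = 0" "\<forall>t. t \<notin> \<Union>D \<longrightarrow> u t = 0" for u :: "'k \<Rightarrow>\<^sub>C 'x"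
  proof (cases "u = 0")
    case False
    then have "\<bar>blinfun_apply \<phi> ((1 / norm u) *\<^sub>R u)\<bar> \<le> \<epsilon>"
      using u by (intro unit) auto
    then show ?thesis using False by (simp add: blinfun.scaleR_right field_simps)
  qed (simp add: blinfun.zero_right)
  then show "\<exists>F. finite F \<and>
      (\<forall>f. (\<forall>t\<in>F. apply_bcontfun f t = 0) \<and> (\<forall>t. t \<notin> \<Union>D \<longrightarrow> f t = 0) \<longrightarrow> \<bar>blinfun_apply \<phi> f\<bar> \<le>
          \<epsilon> * norm f)"
    using F(1) by blast
qed

theorem dispersed_functional_atomic:
  fixes \<phi> :: "('k::t2_space \<Rightarrow>\<^sub>C 'x::real_normed_vector) dual"
  assumes K: "compact (UNIV :: 'k set)" and disp: "dispersed (UNIV :: 'k set)"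
  shows "atomic_on \<phi> UNIV"
proof -
  define W where "W = \<Union>{G. open G \<and> atomic_on \<phi> G}"
  have "open W" unfolding W_def by (intro open_Union) auto
  have W: "atomic_on \<phi> W" unfolding W_def by (rule atomic_on_Union[OF K]) auto
  have "W = UNIV"
  proof (rule ccontr)
    assume "W \<noteq> UNIV"
    moreover have "closedin (top_of_set UNIV) (- W)" using \<open>open W\<close> by auto
    ultimately obtain t where "t isolated_in (- W)"
      using disp unfolding dispersed_def by (metis Compl_empty_eq double_complement)
    then obtain T where T: "open T" "T \<inter> - W = {t}" unfolding isolated_in_def by blast
    \<comment> \<open>Isolation in the complement of \<open>W\<close> lets an open set add just the
      point \<open>t\<close>.\<close>
    have "W \<union> {t} = W \<union> T" using T(2) by blast
    moreover have "open (W \<union> T)" using T(1) \<open>open W\<close> by auto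
    ultimately have "open (W \<union> {t})" by metis
    moreover have "atomic_on \<phi> (W \<union> {t})"
      unfolding atomic_on_def
    proof (intro allI impI)
      fix \<epsilon> :: real assume "0 < \<epsilon>"
      with W obtain F where F: "finite F" "\<And>f. (\<forall>t\<in>F. apply_bcontfun f t = 0) \<Longrightarrow>
          (\<forall>t. t \<notin> W \<longrightarrow> f t = 0) \<Longrightarrow> \<bar>blinfun_apply \<phi> f\<bar> \<le> \<epsilon> * norm f"
        unfolding atomic_on_def by meson
      \<comment> \<open>With \<open>t\<close> among the prescribed zeros, \<open>f\<close> vanishes
        off \<open>W\<close> altogether.\<close>
      have "\<bar>blinfun_apply \<phi> f\<bar> \<le> \<epsilon> * norm f"
        if "\<forall>s\<in>insert t F. f s = 0" "\<forall>s. s \<notin> W \<union> {t} \<longrightarrow> f s = 0" for f :: "'k \<Rightarrow>\<^sub>C 'x"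
      proof (rule F(2))
        show "\<forall>s. s \<notin> W \<longrightarrow> f s = 0"
        proof (intro allI impI)
          fix s assume "s \<notin> W"
          then show "f s = 0" using that by (cases "s = t") auto
        qed
      qed (use that in auto)
      then show "\<exists>F. finite F \<and> (\<forall>f. (\<forall>s\<in>F. apply_bcontfun f s = 0) \<and>
          (\<forall>s. s \<notin> W \<union> {t} \<longrightarrow> f s = 0) \<longrightarrow> \<bar>blinfun_apply \<phi> f\<bar> \<le> \<epsilon> * norm f)"
        using F(1) by (intro exI[of _ "insert t F"]) blast
    qed
    ultimately have "t \<in> W" unfolding W_def by blast
    with T(2) show False by blast
  qed
  with W show ?thesis by metis
qed

section \<open>Existence of the representing measure of a functional\<close>

text \<open>A Lagrange formula with Urysohn functions that are \<open>1\<close> at one node and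
  \<open>0\<close> at the others, clamped afterwards to the largest norm at the nodes. Having all
  bounds \<open>M\<close> inside the statement lets one \<open>f\<close> be chosen independently of
  \<open>M\<close>.\<close>

lemma bcontfun_interpolation:
  fixes g :: "'k::t2_space \<Rightarrow> 'x::real_normed_vector"
  assumes K: "compact (UNIV :: 'k set)" and F: "finite F"
  shows "\<exists>f :: 'k \<Rightarrow>\<^sub>C 'x. (\<forall>t\<in>F. apply_bcontfun f t = g t) \<and>
    (\<forall>M\<ge>0. (\<forall>t\<in>F. norm (g t) \<le> M) \<longrightarrow> norm f \<le> M)"
proof -
  have "\<exists>h :: 'k \<Rightarrow>\<^sub>C real. (\<forall>s. 0 \<le> apply_bcontfun h s) \<and> (\<forall>s. apply_bcontfun h s \<le> 1) \<and>
      (\<forall>s\<in>{t}. apply_bcontfun h s = 1) \<and> (\<forall>s\<in>F - {t}. apply_bcontfun h s = 0)" for t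
    using F by (intro compact_urysohn[OF K] finite_imp_closed) auto
  then have "\<exists>h :: 'k \<Rightarrow>\<^sub>C real. apply_bcontfun h t = 1 \<and> (\<forall>s\<in>F - {t}. apply_bcontfun h s = 0)" for t
    by (meson singletonI)
  then obtain h :: "'k \<Rightarrow> 'k \<Rightarrow>\<^sub>C real" where h: "\<And>t. h t t = 1" "\<And>t s. s \<in> F - {t} \<Longrightarrow> h t s = 0"
    by metis
  define f :: "'k \<Rightarrow>\<^sub>C 'x" where "f = (\<Sum>t\<in>F. bcontfun_scale (h t) (const_bcontfun (g t)))"
  have apply_sum: "apply_bcontfun (sum u S) s = (\<Sum>t\<in>S. apply_bcontfun (u t) s)"
    for u :: "'k \<Rightarrow> 'k \<Rightarrow>\<^sub>C 'x" and S s
    by (induction S rule: infinite_finite_induct) auto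
  have f: "f s = g s" if "s \<in> F" for s
  proof -
    have "f s = (\<Sum>t\<in>F. h t s *\<^sub>R g t)" by (simp add: f_def apply_sum const_bcontfun.rep_eq)
    also have "\<dots> = (\<Sum>t\<in>F. if t = s then g s else 0)"
      using h that by (intro sum.cong) auto
    finally show ?thesis using F that by simp
  qed
  \<comment> \<open>The \<open>0\<close> covers empty \<open>F\<close>; the case
    \<open>c = 0\<close> is separated because clamping needs a positive radius.\<close>
  define c where "c = Max (insert 0 ((\<lambda>t. norm (g t)) ` F))"
  have c: "0 \<le> c" "\<And>t. t \<in> F \<Longrightarrow> norm (g t) \<le> c" "\<And>M. 0 \<le> M \<Longrightarrow> (\<forall>t\<in>F. norm (g t) \<le> M) \<Longrightarrow> c \<le> M"
    unfolding c_def using F by auto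
  show ?thesis
  proof (cases "c = 0")
    case True
    then show ?thesis using c by (intro exI[of _ 0]) auto
  next
    case False
    then have "0 < c" using c(1) by simp
    then obtain u :: "'k \<Rightarrow>\<^sub>C 'x" where u: "\<And>t. norm (apply_bcontfun u t) \<le> c" "\<And>t. norm (f t) \<le>
        c \<Longrightarrow> u t = f t"
        "\<And>t. norm (f t - u t) \<le> norm (f t)"
      using radial_clamp[of c f] by blast
    have "norm u \<le> c" using u(1) by (rule norm_bound)
    then have "norm u \<le> M" if "0 \<le> M" "\<forall>t\<in>F. norm (g t) \<le> M" for M
      using c(3)[OF that] by simp
    moreover have "\<forall>t\<in>F. u t = g t" using u(2) f c(2) by simp
    ultimately show ?thesis by blast
  qed
qed

text \<open>The \<open>x i\<close> can be chosen independently, each nearly norming for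
  \<open>L i\<close> and with the right sign; the loss is spread evenly over \<open>I\<close>. This
  turns bounds on a functional into bounds on variation.\<close>

lemma sum_blinfun_norming:
  fixes L :: "'i \<Rightarrow> 'a::real_normed_vector dual"
  assumes I: "finite I" and le: "\<And>x. (\<And>i. i \<in> I \<Longrightarrow> norm (x i) \<le> 1) \<Longrightarrow>
      (\<Sum>i\<in>I. blinfun_apply (L i) (x i)) \<le> c"
  shows "(\<Sum>i\<in>I. norm (L i)) \<le> c"
proof (rule field_le_epsilon)
  fix e :: real assume e: "0 < e"
  define d where "d = e / (real (card I) + 1)"
  have d: "0 < d" unfolding d_def using e by (simp add: add_nonneg_pos)
  have "\<exists>x. norm x \<le> 1 \<and> norm (L i) - d \<le> blinfun_apply (L i) x" for i
  proof -
    obtain x where x: "norm x \<le> 1" "norm (L i) - d < norm (blinfun_apply (L i) x)"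
      using blinfun_norm_attained_approx[of "norm (L i) - d" "L i"] d by auto
    then show ?thesis
      by (cases "0 \<le> blinfun_apply (L i) x")
        (force intro: exI[of _ x] exI[of _ "- x"] simp: blinfun.minus_right)+
  qed
  then obtain x where x: "\<And>i. norm (x i) \<le> 1" "\<And>i. norm (L i) - d \<le> blinfun_apply (L i) (x i)"
    by metis
  have "(\<Sum>i\<in>I. norm (L i)) - card I * d = (\<Sum>i\<in>I. norm (L i) - d)"
    by (simp add: sum_subtractf)
  also have "\<dots> \<le> (\<Sum>i\<in>I. blinfun_apply (L i) (x i))" using x by (intro sum_mono)
  also have "\<dots> \<le> c" using x by (intro le)
  finally have "(\<Sum>i\<in>I. norm (L i)) \<le> c + card I * d" by simp
  also have "card I * d \<le> e" unfolding d_def using e by (simp add: field_simps)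
  finally show "(\<Sum>i\<in>I. norm (L i)) \<le> c + e" by simp
qed

text \<open>The range is covered by finitely many balls, and taking the first ball that contains
  \<open>f t\<close> makes the cells Borel and disjoint. Simplicity is checked for the
  \<open>nat\<close>-valued index and then passed to the centres by composition.\<close>

lemma uniform_simple_approximation:
  fixes f :: "'k::t2_space \<Rightarrow>\<^sub>C 'x::real_normed_vector"
  assumes K: "compact (UNIV :: 'k set)" and e: "0 < e"
  obtains s where "simple_function borel s" "\<And>t. dist (s t) (f t) < e"
proof -
  have "compact (range f)" using K by (intro compact_continuous_image) auto
  then obtain Z where Z: "finite Z" "range f \<subseteq> (\<Union>z\<in>Z. ball z e)"
    using e unfolding compact_eq_totally_bounded by blast
  obtain n :: nat and z where z: "Z = z ` {i. i < n}"
    using finite_imp_nat_seg_image_inj_on[OF Z(1)] by metis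
  define idx where "idx t = (LEAST i. dist (z i) (f t) < e)" for t
  have ex: "\<exists>i<n. dist (z i) (f t) < e" for t
  proof -
    have "f t \<in> (\<Union>w\<in>Z. ball w e)" using Z(2) by blast
    then show ?thesis unfolding z by auto
  qed
  then have idx: "dist (z (idx t)) (f t) < e" for t
    unfolding idx_def by (metis (mono_tags, lifting) LeastI_ex)
  have idx_less: "idx t < n" for t
    unfolding idx_def using ex by (metis (mono_tags, lifting) Least_le le_less_trans)
  have meas: "{t. dist (z i) (f t) < e} \<in> sets borel" for i
    by (intro borel_open open_Collect_less continuous_intros) auto
  have idx_iff: "idx t = i \<longleftrightarrow> dist (z i) (f t) < e \<and> (\<forall>j<i. \<not> dist (z j) (f t) < e)" for t i
    unfolding idx_def using idx[of t, unfolded idx_def]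
    by (metis (mono_tags, lifting) LeastI Least_le not_less_Least nat_neq_iff leD)
  have "idx -` {i} \<in> sets borel" for i
  proof -
    have "idx -` {i} = {t. dist (z i) (f t) < e} - (\<Union>j<i. {t. dist (z j) (f t) < e})"
      using idx_iff by auto
    then show ?thesis using meas by auto
  qed
  moreover have "finite (range idx)"
    by (rule finite_subset[OF image_subsetI finite_lessThan[of n]]) (simp add: idx_less)
  ultimately have "simple_function borel idx" by (auto simp: simple_function_def)
  then have "simple_function borel (\<lambda>t. z (idx t))" by (rule simple_function_compose1)
  then show thesis by (rule that) (rule idx)
qed

text \<open>Atomicity along one increasing sequence of finite sets, so that limits over
  \<open>n\<close> replace the quantifier over \<open>\<epsilon>\<close>.\<close>

locale atomic_functional =
  fixes \<phi> :: "('k::t2_space \<Rightarrow>\<^sub>C 'x::real_normed_vector) dual" and F :: "nat \<Rightarrow> 'k set"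
  assumes K: "compact (UNIV :: 'k set)" and fin: "finite (F n)" and inc: "incseq F"
    and small: "(\<forall>t\<in>F n. apply_bcontfun f t = 0) \<Longrightarrow> \<bar>blinfun_apply \<phi> f\<bar> \<le> norm f / real (Suc n)"
begin

section \<open>Extension of the functional to bounded functions\<close>

definition interp :: "nat \<Rightarrow> ('k \<Rightarrow> 'x) \<Rightarrow> 'k \<Rightarrow>\<^sub>C 'x"
  where "interp n g = (SOME f. (\<forall>t\<in>F n. apply_bcontfun f t = g t) \<and>
    (\<forall>M\<ge>0. (\<forall>t\<in>F n. norm (g t) \<le> M) \<longrightarrow> norm f \<le> M))"

lemma
  shows interp_apply: "t \<in> F n \<Longrightarrow> interp n g t = g t"
    and norm_interp_le: "0 \<le> M \<Longrightarrow> (\<And>t. t \<in> F n \<Longrightarrow> norm (g t) \<le> M) \<Longrightarrow> norm (interp n g) \<le> M"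
  unfolding interp_def using someI_ex[OF bcontfun_interpolation[OF K fin, of n g]] by blast+

text \<open>For bounded \<open>g\<close> the sequence is Cauchy, since two interpolants agree on the
  smaller of their finite sets. Continuity or measurability of \<open>g\<close> does not
  enter.\<close>

definition extend :: "('k \<Rightarrow> 'x) \<Rightarrow> real"
  where "extend g = lim (\<lambda>n. blinfun_apply \<phi> (interp n g))"

lemma agree_diff:
  assumes "\<forall>t\<in>F n. apply_bcontfun f t = apply_bcontfun g t" "norm f \<le> M" "norm g \<le> N"
  shows "\<bar>blinfun_apply \<phi> f - blinfun_apply \<phi> g\<bar> \<le> (M + N) / real (Suc n)"
proof -
  have "\<bar>blinfun_apply \<phi> (f - g)\<bar> \<le> norm (f - g) / real (Suc n)"
    using assms(1) by (intro small) simp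
  also have "norm (f - g) \<le> M + N" using assms(2,3) norm_triangle_ineq4[of f g] by simp
  finally show ?thesis by (simp add: blinfun.diff_right divide_right_mono)
qed

lemma bound_nonneg: "(\<And>t. norm (g t) \<le> M) \<Longrightarrow> 0 \<le> M"
  using norm_ge_zero order_trans by blast

lemma extend_tendsto_interp:
  assumes g: "\<And>t. norm (g t) \<le> M"
  shows "(\<lambda>n. blinfun_apply \<phi> (interp n g)) \<longlonglongrightarrow> extend g"
proof -
  have M: "0 \<le> M" using bound_nonneg[of g] g by blast
  have d: "\<bar>blinfun_apply \<phi> (interp m g) - blinfun_apply \<phi> (interp n g)\<bar> \<le> (M + M) / real (Suc n)"
    if "n \<le> m" for m n
  proof (rule agree_diff)
    have "F n \<subseteq> F m" using inc that by (simp add: incseqD)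
    then show "\<forall>t\<in>F n. interp m g t = interp n g t" by (simp add: interp_apply subset_iff)
  qed (use g M norm_interp_le in auto)
  have "Cauchy (\<lambda>n. blinfun_apply \<phi> (interp n g))"
  proof (rule CauchyI')
    fix e :: real assume e: "0 < e"
    obtain N where N: "(M + M) / e < real N" using reals_Archimedean2 by blast
    have "dist (blinfun_apply \<phi> (interp m g)) (blinfun_apply \<phi> (interp n g)) < e" if "N \<le> m"
        "m < n" for m n
    proof -
      have "(M + M) / e < real (Suc m)" using N that by simp
      then have "(M + M) / real (Suc m) < e" using e by (simp add: field_simps)
      then show ?thesis using d[of m n] that by (simp add: dist_real_def)
    qed
    then show "\<exists>M. \<forall>m\<ge>M. \<forall>n>m. dist (blinfun_apply \<phi> (interp m g)) (blinfun_apply \<phi> (interp n g))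
        < e" by blast
  qed
  then show ?thesis
    unfolding extend_def by (simp add: Cauchy_convergent_iff convergent_LIMSEQ_iff)
qed

text \<open>\<open>interp\<close> is an arbitrary choice and not linear in \<open>g\<close>. This
  frees \<open>extend\<close> from it: a sum of interpolants is again a bounded interpolating
  sequence, whence linearity.\<close>

lemma extend_tendsto:
  assumes g: "\<And>t. norm (g t) \<le> M" and f: "\<And>n t. t \<in> F n \<Longrightarrow> apply_bcontfun (f n) t = g t"
    and N: "\<And>n. norm (f n) \<le> N"
  shows "(\<lambda>n. blinfun_apply \<phi> (f n)) \<longlonglongrightarrow> extend g"
proof -
  have M: "0 \<le> M" using bound_nonneg[of g] g by blast
  have "\<bar>blinfun_apply \<phi> (f n) - blinfun_apply \<phi> (interp n g)\<bar> \<le> (N + M) * (1 / real (Suc n))" for n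
    using agree_diff[of n "f n" "interp n g" N M] f N norm_interp_le[of M n g] g M
    by (auto simp: interp_apply)
  moreover have "(\<lambda>n. (N + M) * (1 / real (Suc n))) \<longlonglongrightarrow> 0"
    using tendsto_mult_right_zero[OF LIMSEQ_Suc[OF lim_1_over_n]] by simp
  ultimately have "(\<lambda>n. blinfun_apply \<phi> (f n) - blinfun_apply \<phi> (interp n g)) \<longlonglongrightarrow> 0"
    unfolding real_norm_def[symmetric] by (rule Lim_null_comparison[OF always_eventually, OF allI])
  from tendsto_add[OF this extend_tendsto_interp[of g M, OF g]] show ?thesis by simp
qed

lemma extend_bcontfun: "extend (apply_bcontfun f) = blinfun_apply \<phi> f"
proof -
  have "(\<lambda>n. blinfun_apply \<phi> f) \<longlonglongrightarrow> extend (apply_bcontfun f)"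
    by (rule extend_tendsto[where M="norm f" and N="norm f"]) (auto simp: norm_bounded)
  then show ?thesis using LIMSEQ_unique tendsto_const by blast
qed

lemma extend_add:
  assumes g: "\<And>t. norm (g t) \<le> M" and h: "\<And>t. norm (h t) \<le> N"
  shows "extend (\<lambda>t. g t + h t) = extend g + extend h"
proof -
  have "(\<lambda>n. blinfun_apply \<phi> (interp n g + interp n h)) \<longlonglongrightarrow> extend (\<lambda>t. g t + h t)"
  proof (rule extend_tendsto)
    show "norm (interp n g + interp n h) \<le> M + N" for n
      using g h bound_nonneg[of g] bound_nonneg[of h]
      by (intro norm_triangle_mono norm_interp_le) blast+
    show "norm (g t + h t) \<le> M + N" for t using g h by (intro norm_triangle_mono)
  qed (simp add: interp_apply)
  moreover have "(\<lambda>n. blinfun_apply \<phi> (interp n g + interp n h)) \<longlonglongrightarrow> extend g + extend h"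
    unfolding blinfun.add_right
    by (intro tendsto_add extend_tendsto_interp) (rule g h)+
  ultimately show ?thesis by (rule LIMSEQ_unique)
qed

lemma extend_scaleR:
  assumes g: "\<And>t. norm (g t) \<le> M"
  shows "extend (\<lambda>t. c *\<^sub>R g t) = c * extend g"
proof -
  have "(\<lambda>n. blinfun_apply \<phi> (c *\<^sub>R interp n g)) \<longlonglongrightarrow> extend (\<lambda>t. c *\<^sub>R g t)"
  proof (rule extend_tendsto)
    show "norm (c *\<^sub>R interp n g) \<le> \<bar>c\<bar> * M" for n
      using g bound_nonneg[OF g] by (simp add: mult_left_mono norm_interp_le)
    show "norm (c *\<^sub>R g t) \<le> \<bar>c\<bar> * M" for t using g by (simp add: mult_left_mono)
  qed (simp add: interp_apply)
  moreover have "(\<lambda>n. blinfun_apply \<phi> (c *\<^sub>R interp n g)) \<longlonglongrightarrow> c * extend g"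
    unfolding blinfun.scaleR_right real_scaleR_def
    by (intro tendsto_mult_left extend_tendsto_interp) (rule g)
  ultimately show ?thesis by (rule LIMSEQ_unique)
qed

lemma extend_zero: "extend (\<lambda>t. 0) = 0"
  using extend_scaleR[of "\<lambda>t. 0" 0 0] by simp

lemma extend_sum:
  assumes "finite I" "\<And>i t. i \<in> I \<Longrightarrow> norm (g i t) \<le> M i"
  shows "extend (\<lambda>t. \<Sum>i\<in>I. g i t) = (\<Sum>i\<in>I. extend (g i))"
  using assms
proof (induction I rule: finite_induct)
  case (insert i I)
  have "norm (\<Sum>i\<in>I. g i t) \<le> (\<Sum>i\<in>I. M i)" for t
    using insert.prems by (intro sum_norm_le) auto
  then have "extend (\<lambda>t. g i t + (\<Sum>i\<in>I. g i t)) = extend (g i) + extend (\<lambda>t. \<Sum>i\<in>I. g i t)"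
    using insert.prems by (intro extend_add[of _ "M i"]) auto
  then show ?case using insert by simp
qed (simp add: extend_zero)

lemma extend_le:
  assumes g: "\<And>t. norm (g t) \<le> M"
  shows "\<bar>extend g\<bar> \<le> norm \<phi> * M"
proof (rule LIMSEQ_le_const2[OF tendsto_rabs[OF extend_tendsto_interp[of g M, OF g]]])
  have "\<bar>blinfun_apply \<phi> (interp n g)\<bar> \<le> norm \<phi> * M" for n
    using g bound_nonneg[of g] by (intro functional_le norm_interp_le) blast+
  then show "\<exists>N. \<forall>n\<ge>N. \<bar>blinfun_apply \<phi> (interp n g)\<bar> \<le> norm \<phi> * M" by blast
qed

text \<open>Smallness off \<open>F n\<close> survives the limit because later sets contain
  \<open>F n\<close>. Both countable additivity and regularity of the measure rest on it.\<close>

lemma extend_le_off: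
  assumes g: "\<And>t. norm (g t) \<le> M" and 0: "\<And>t. t \<in> F n \<Longrightarrow> g t = 0"
  shows "\<bar>extend g\<bar> \<le> M / real (Suc n)"
proof (rule LIMSEQ_le_const2[OF tendsto_rabs[OF extend_tendsto_interp[of g M, OF g]]])
  have "\<bar>blinfun_apply \<phi> (interp m g)\<bar> \<le> M / real (Suc n)" if "n \<le> m" for m
  proof -
    have "F n \<subseteq> F m" using inc that by (simp add: incseqD)
    then have "\<bar>blinfun_apply \<phi> (interp m g)\<bar> \<le> norm (interp m g) / real (Suc n)"
      using 0 by (intro small) (auto simp: interp_apply subset_iff)
    also have "\<dots> \<le> M / real (Suc n)"
      using g bound_nonneg[of g M] by (intro divide_right_mono norm_interp_le) auto
    finally show ?thesis .
  qed
  then show "\<exists>N. \<forall>m\<ge>N. \<bar>blinfun_apply \<phi> (interp m g)\<bar> \<le> M / real (Suc n)" by blast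
qed

section \<open>The measure induced by the extension\<close>

definition \<mu> :: "'k set \<Rightarrow> 'x dual"
  where "\<mu> A = Blinfun (\<lambda>x. extend (\<lambda>t. indicat_real A t *\<^sub>R x))"

lemma norm_indicator_scaleR_le: "norm (indicat_real A t *\<^sub>R x) \<le> norm x"
  by (simp add: indicator_def)

lemma \<mu>_apply: "blinfun_apply (\<mu> A) x = extend (\<lambda>t. indicat_real A t *\<^sub>R x)"
proof -
  have "bounded_linear (\<lambda>x. extend (\<lambda>t. indicat_real A t *\<^sub>R x))"
  proof (rule bounded_linear_intro)
    fix x y :: 'x and c :: real
    show "extend (\<lambda>t. indicat_real A t *\<^sub>R (x + y)) =
        extend (\<lambda>t. indicat_real A t *\<^sub>R x) + extend (\<lambda>t. indicat_real A t *\<^sub>R y)"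
      unfolding scaleR_add_right by (rule extend_add) (rule norm_indicator_scaleR_le)+
    show "extend (\<lambda>t. indicat_real A t *\<^sub>R (c *\<^sub>R x)) = c *\<^sub>R extend (\<lambda>t. indicat_real A t *\<^sub>R x)"
      using extend_scaleR[of "\<lambda>t. indicat_real A t *\<^sub>R x" "norm x" c, OF norm_indicator_scaleR_le]
          by (simp add: mult.commute)
    show "norm (extend (\<lambda>t. indicat_real A t *\<^sub>R x)) \<le> norm x * norm \<phi>"
      using extend_le[of "\<lambda>t. indicat_real A t *\<^sub>R x" "norm x", OF norm_indicator_scaleR_le]
          by (simp add: mult.commute)
  qed
  then show ?thesis by (simp add: \<mu>_def bounded_linear_Blinfun_apply)
qed

lemma sum_\<mu>_apply:
  assumes "finite I"
  shows "(\<Sum>i\<in>I. blinfun_apply (\<mu> (A i)) (x i)) = extend (\<lambda>t. \<Sum>i\<in>I. indicat_real (A i) t *\<^sub>R x i)"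
  unfolding \<mu>_apply using assms norm_indicator_scaleR_le by (intro extend_sum[symmetric]) auto

lemma norm_\<mu>_le:
  assumes "A \<inter> F n = {}"
  shows "norm (\<mu> A) \<le> 1 / real (Suc n)"
proof (rule norm_blinfun_bound)
  fix x
  have "\<bar>extend (\<lambda>t. indicat_real A t *\<^sub>R x)\<bar> \<le> norm x / real (Suc n)"
    using assms by (intro extend_le_off norm_indicator_scaleR_le) (auto simp: indicator_def)
  then show "norm (blinfun_apply (\<mu> A) x) \<le> 1 / real (Suc n) * norm x" by (simp add: \<mu>_apply)
qed simp

lemma \<mu>_Un: "A \<inter> B = {} \<Longrightarrow> \<mu> (A \<union> B) = \<mu> A + \<mu> B"
proof (rule blinfun_eqI)
  fix x :: 'x assume "A \<inter> B = {}"
  then have "(\<lambda>t. indicat_real (A \<union> B) t *\<^sub>R x) = (\<lambda>t. indicat_real A t *\<^sub>R x +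
      indicat_real B t *\<^sub>R x)"
    by (auto simp: fun_eq_iff indicator_def split: if_splits)
  then show "blinfun_apply (\<mu> (A \<union> B)) x = blinfun_apply (\<mu> A + \<mu> B) x"
    using extend_add[of "\<lambda>t. indicat_real A t *\<^sub>R x" "norm x" "\<lambda>t. indicat_real B t *\<^sub>R x" "norm x",
        OF norm_indicator_scaleR_le norm_indicator_scaleR_le]
    by (simp add: \<mu>_apply blinfun.add_left)
qed

lemma \<mu>_empty: "\<mu> {} = 0"
  using \<mu>_Un[of "{}" "{}"] by simp

lemma \<mu>_finite_UN: "disjoint_family A \<Longrightarrow> \<mu> (\<Union>i<N. A i) = (\<Sum>i<N. \<mu> (A i))" for N :: nat
proof (induction N)
  case (Suc N)
  have "A N \<inter> A i = {}" if "i < N" for i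
    using disjoint_family_onD[OF Suc.prems, of N i] that by simp
  then have "\<mu> (A N \<union> (\<Union>i<N. A i)) = \<mu> (A N) + \<mu> (\<Union>i<N. A i)"
    by (intro \<mu>_Un) blast
  then show ?case using Suc by (simp add: lessThan_Suc add.commute)
qed (simp add: \<mu>_empty)

text \<open>Each point lies in at most one \<open>A i\<close>, so the tails of the union eventually
  miss the finite set \<open>F n\<close>; on sets missing \<open>F n\<close> the measure has norm at
  most \<open>1 / Suc n\<close>.\<close>

lemma \<mu>_sums:
  assumes A: "disjoint_family A"
  shows "(\<lambda>i. \<mu> (A i)) sums \<mu> (\<Union>i. A i)"
  unfolding sums_def
proof (rule LIMSEQ_I)
  fix r :: real assume "0 < r"
  then obtain n where n: "1 / real (Suc n) < r" using nat_approx_posE by blast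
  have "\<forall>\<^sub>F N in sequentially. t \<notin> (\<Union>i\<in>{N..}. A i)" for t
  proof (cases "t \<in> (\<Union>i. A i)")
    case True
    then obtain i where i: "t \<in> A i" by blast
    have "t \<notin> (\<Union>j\<in>{N..}. A j)" if "Suc i \<le> N" for N
    proof
      assume "t \<in> (\<Union>j\<in>{N..}. A j)"
      then obtain j where "N \<le> j" "t \<in> A j" by auto
      then show False using A i that unfolding disjoint_family_on_def
        by (metis IntI Suc_n_not_le_n UNIV_I empty_iff order_trans)
    qed
    then show ?thesis by (rule eventually_sequentiallyI)
  qed auto
  then have "\<forall>\<^sub>F N in sequentially. \<forall>t\<in>F n. t \<notin> (\<Union>i\<in>{N..}. A i)"
    using fin by (simp add: eventually_ball_finite)
  then obtain N where N: "\<And>m. N \<le> m \<Longrightarrow> \<forall>t\<in>F n. t \<notin> (\<Union>i\<in>{m..}. A i)"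
    unfolding eventually_sequentially by blast
  have "norm ((\<Sum>i<m. \<mu> (A i)) - \<mu> (\<Union>i. A i)) < r" if "N \<le> m" for m
  proof -
    have "(\<Union>i. A i) = (\<Union>i<m. A i) \<union> (\<Union>i\<in>{m..}. A i)"
      unfolding UN_Un[symmetric] by (intro arg_cong[of _ _ "\<lambda>I. \<Union>i\<in>I. A i"]) auto
    moreover have "(\<Union>i<m. A i) \<inter> (\<Union>i\<in>{m..}. A i) = {}"
    proof -
      have "A i \<inter> A j = {}" if "i < m" "m \<le> j" for i j
        using disjoint_family_onD[OF A, of i j] that by simp
      then show ?thesis by (auto dest!: equals0D)
    qed
    ultimately have "\<mu> (\<Union>i. A i) = \<mu> (\<Union>i<m. A i) + \<mu> (\<Union>i\<in>{m..}. A i)"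
      using \<mu>_Un by metis
    moreover have "norm (\<mu> (\<Union>i\<in>{m..}. A i)) \<le> 1 / real (Suc n)"
      using N[OF that] by (intro norm_\<mu>_le) blast
    ultimately show ?thesis using n A by (simp add: \<mu>_finite_UN)
  qed
  then show "\<exists>N. \<forall>m\<ge>N. norm ((\<Sum>i<m. \<mu> (A i)) - \<mu> (\<Union>i. A i)) < r" by blast
qed

text \<open>By \<open>sum_blinfun_norming\<close> a sum of norms over a partition is controlled by
  values of \<open>extend\<close> at step functions; disjointness of the cells keeps their sup norm
  at most \<open>1\<close>.\<close>

lemma variation_\<mu>_le:
  assumes "\<And>g. (\<And>t. norm (g t) \<le> 1) \<Longrightarrow> (\<And>t. t \<notin> E \<Longrightarrow> g t = 0) \<Longrightarrow> extend g \<le> c"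
  shows "variation \<mu> E \<le> ennreal c"
  unfolding variation_def
proof (rule SUP_least)
  fix P :: "'k set set"
  assume "P \<in> {P. finite P \<and> disjoint P \<and> P \<subseteq> sets borel \<and> \<Union>P = E}"
  then have P: "finite P" "disjoint P" and E: "E = \<Union>P" by auto
  have "(\<Sum>A\<in>P. blinfun_apply (\<mu> A) (x A)) \<le> c" if x: "\<And>A. A \<in> P \<Longrightarrow> norm (x A) \<le> 1" for x
    unfolding sum_\<mu>_apply[OF P(1)]
  proof (rule assms)
    fix t
    show "norm (\<Sum>A\<in>P. indicat_real A t *\<^sub>R x A) \<le> 1"
    proof (cases "t \<in> \<Union>P")
      case True
      then obtain B where B: "B \<in> P" "t \<in> B" by blast
      have "(\<Sum>A\<in>P. indicat_real A t *\<^sub>R x A) = (\<Sum>A\<in>P. if A = B then x B else 0)"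
        using P(2) B by (intro sum.cong) (auto simp: indicator_def disjoint_def)
      then show ?thesis using x B P(1) by simp
    qed (auto intro!: order_trans[OF _ zero_le_one] simp: sum.neutral)
    show "(\<Sum>A\<in>P. indicat_real A t *\<^sub>R x A) = 0" if "t \<notin> E"
      using that E by (intro sum.neutral) auto
  qed
  then have "(\<Sum>A\<in>P. norm (\<mu> A)) \<le> c" by (rule sum_blinfun_norming[OF P(1)])
  then show "(\<Sum>A\<in>P. ennreal (norm (\<mu> A))) \<le> ennreal c" by (simp add: ennreal_leI)
qed

lemma variation_\<mu>_UNIV: "variation \<mu> UNIV \<le> ennreal (norm \<phi>)"
  by (rule variation_\<mu>_le) (use extend_le[of _ 1] in \<open>simp add: abs_le_iff\<close>)

lemma variation_\<mu>_off: "variation \<mu> (- F n) \<le> ennreal (1 / real (Suc n))"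
  by (rule variation_\<mu>_le) (use extend_le_off[of _ 1] in \<open>simp add: abs_le_iff\<close>)

lemma \<mu>_in_rcabv: "\<mu> \<in> rcabv"
  unfolding rcabv_def
proof (intro CollectI conjI allI ballI impI)
  show "(\<lambda>i. \<mu> (A i)) sums \<mu> (\<Union>i. A i)" if "range A \<subseteq> sets borel \<and> disjoint_family A" for A
    using that by (intro \<mu>_sums) simp
  show "variation \<mu> UNIV < \<infinity>"
    using variation_\<mu>_UNIV by (rule le_less_trans) simp
  fix A :: "'k set" and \<epsilon> :: ennreal assume "0 < \<epsilon>"
  have "\<exists>n. ennreal (1 / real (Suc n)) < \<epsilon>"
  proof (cases \<epsilon>)
    case (real r)
    with \<open>0 < \<epsilon>\<close> have "0 < r" by simp
    then obtain n where "1 / real (Suc n) < r" using nat_approx_posE by blast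
    with \<open>0 < r\<close> have "ennreal (1 / real (Suc n)) < \<epsilon>" unfolding real by (rule ennreal_lessI)
    then show ?thesis ..
  qed simp
  then obtain n where n: "ennreal (1 / real (Suc n)) < \<epsilon>" ..
  \<comment> \<open>Finite sets are compact with open complement: \<open>A\<close> is squeezed
    between \<open>A \<inter> F n\<close> and the complement of \<open>F n - A\<close>, and the gap
    is exactly \<open>- F n\<close>.\<close>
  have "- (F n - A) - A \<inter> F n = - F n" by blast
  then have "variation \<mu> (- (F n - A) - A \<inter> F n) < \<epsilon>"
    using le_less_trans[OF variation_\<mu>_off n] by simp
  moreover have "compact (A \<inter> F n)" "open (- (F n - A))"
    using fin[of n] by (auto intro!: finite_imp_compact open_Compl finite_imp_closed simp del:
        Compl_Diff_eq)
  ultimately show "\<exists>C U. compact C \<and> open U \<and> C \<subseteq> A \<and> A \<subseteq> U \<and> variation \<mu> (U - C) < \<epsilon>"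
    by (intro exI[of _ "A \<inter> F n"] exI[of _ "- (F n - A)"]) auto
qed

lemma simple_integral_\<mu>:
  assumes "finite (range s)"
  shows "simple_integral_vm \<mu> s = extend s"
proof -
  have "(\<Sum>v\<in>range s. indicat_real (s -` {v}) t *\<^sub>R v) = (\<Sum>v\<in>range s. if v = s t then v else 0)"
      for t
    by (intro sum.cong) (auto simp: indicator_def)
  then have "(\<lambda>t. \<Sum>v\<in>range s. indicat_real (s -` {v}) t *\<^sub>R v) = s"
    using assms by simp
  then show ?thesis
    unfolding simple_integral_vm_def using sum_\<mu>_apply[OF assms, of "\<lambda>v. s -` {v}" "\<lambda>v. v"] by simp
qed

text \<open>\<open>extend\<close> acts on the simple functions and on \<open>f\<close> alike, so the
  error of an approximating sum is \<open>extend\<close> of the uniformly small difference.\<close>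

lemma has_integral_\<mu>: "has_integral_vm \<mu> (apply_bcontfun f) (blinfun_apply \<phi> f)"
proof -
  have "\<exists>s. simple_function borel s \<and> (\<forall>t. dist (s t) (f t) < 1 / real (Suc n))" for n
    using uniform_simple_approximation[OF K, of "1 / real (Suc n)" f]
        by (metis zero_less_divide_1_iff of_nat_0_less_iff zero_less_Suc)
  then obtain s where s: "\<And>n. simple_function borel (s n)"
    and close: "\<And>n t. dist (s n t) (f t) < 1 / real (Suc n)" by metis
  have lim0: "(\<lambda>n. 1 / real (Suc n)) \<longlonglongrightarrow> 0" using LIMSEQ_Suc[OF lim_1_over_n] .
  have "uniform_limit UNIV s f sequentially"
  proof (rule uniform_limitI)
    fix e :: real assume "0 < e"
    from order_tendstoD(2)[OF lim0 this]
    show "\<forall>\<^sub>F n in sequentially. \<forall>t\<in>UNIV. dist (s n t) (f t) < e"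
      by eventually_elim (use close less_trans in blast)
  qed
  moreover have "(\<lambda>n. simple_integral_vm \<mu> (s n)) \<longlonglongrightarrow> blinfun_apply \<phi> f"
  proof -
    have "\<bar>simple_integral_vm \<mu> (s n) - blinfun_apply \<phi> f\<bar> \<le> norm \<phi> * (1 / real (Suc n))" for n
    proof -
      have fr: "finite (range (s n))" using simple_functionD(1)[OF s] by simp
      then obtain M where M: "\<And>t. norm (s n t) \<le> M"
        using finite_imp_bounded[OF fr] unfolding bounded_iff by auto
      have d: "norm (s n t - f t) \<le> 1 / real (Suc n)" for t
        using close[of n t] by (simp add: dist_norm)
      have "extend (\<lambda>t. (s n t - f t) + f t) = extend (\<lambda>t. s n t - f t) + extend f"
        using d norm_bounded by (rule extend_add)
      then have "simple_integral_vm \<mu> (s n) - blinfun_apply \<phi> f = extend (\<lambda>t. s n t - f t)"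
        using simple_integral_\<mu>[OF fr] extend_bcontfun[of f] by simp
      then show ?thesis using extend_le[OF d] by simp
    qed
    then have "\<forall>\<^sub>F n in sequentially. norm (simple_integral_vm \<mu> (s n) - blinfun_apply \<phi> f)
        \<le> norm \<phi> * (1 / real (Suc n))"
      by (intro always_eventually allI) (simp only: real_norm_def)
    then have "(\<lambda>n. simple_integral_vm \<mu> (s n) - blinfun_apply \<phi> f) \<longlonglongrightarrow> 0"
      by (rule Lim_null_comparison) (rule tendsto_mult_right_zero[OF lim0])
    then show ?thesis by (rule LIM_zero_cancel)
  qed
  ultimately show ?thesis unfolding has_integral_vm_def using s by blast
qed

end

text \<open>The third conclusion is recorded so that the measure picked by \<open>SOME\<close> can
  inherit it through uniqueness.\<close>

theorem dispersed_representing_measure: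
  fixes \<phi> :: "('k::t2_space \<Rightarrow>\<^sub>C 'x::real_normed_vector) dual"
  assumes K: "compact (UNIV :: 'k set)" and disp: "dispersed (UNIV :: 'k set)"
  obtains \<mu> where "\<mu> \<in> rcabv" "\<And>f. has_integral_vm \<mu> (apply_bcontfun f) (blinfun_apply \<phi> f)"
    "\<And>\<epsilon>. 0 < \<epsilon> \<Longrightarrow> \<exists>F. finite F \<and> variation \<mu> (- F) \<le> ennreal \<epsilon>"
proof -
  have "\<exists>F. finite F \<and> (\<forall>f. (\<forall>t\<in>F. apply_bcontfun f t = 0) \<longrightarrow> \<bar>blinfun_apply \<phi> f\<bar> \<le>
      1 / real (Suc n) * norm f)" for n
    using dispersed_functional_atomic[OF K disp, of \<phi>] unfolding atomic_on_def
    by (metis UNIV_I zero_less_divide_1_iff of_nat_0_less_iff zero_less_Suc)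
  then obtain E where E: "\<And>n. finite (E n)" "\<And>n f. \<forall>t\<in>E n. apply_bcontfun f t = 0 \<Longrightarrow>
      \<bar>blinfun_apply \<phi> f\<bar> \<le> 1 / real (Suc n) * norm f"
    by metis
  interpret atomic_functional \<phi> "\<lambda>n. \<Union>i\<le>n. E i"
  proof
    show "incseq (\<lambda>n. \<Union>i\<le>n. E i)" by (force simp: incseq_def)
    show "\<bar>blinfun_apply \<phi> f\<bar> \<le> norm f / real (Suc n)" if "\<forall>t\<in>\<Union>i\<le>n. E i. apply_bcontfun f t = 0"
        for f n
    proof -
      have "\<forall>t\<in>E n. apply_bcontfun f t = 0" using that by blast
      then show ?thesis using E(2)[of n f] by simp
    qed
  qed (use K E in auto)
  show thesis
  proof (rule that[OF \<mu>_in_rcabv has_integral_\<mu>])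
    fix \<epsilon> :: real assume "0 < \<epsilon>"
    then obtain n where "1 / real (Suc n) < \<epsilon>" using nat_approx_posE by blast
    then show "\<exists>F. finite F \<and> variation \<mu> (- F) \<le> ennreal \<epsilon>"
      using fin variation_\<mu>_off[of n] by (meson ennreal_leI less_imp_le order_trans)
  qed
qed

section \<open>Integral estimates and uniqueness of the representing measure\<close>

lemma rcabv_sums:
  "\<mu> \<in> rcabv \<Longrightarrow> range A \<subseteq> sets borel \<Longrightarrow> disjoint_family A \<Longrightarrow> (\<lambda>i. \<mu> (A i)) sums \<mu> (\<Union>i. A i)"
  by (simp add: rcabv_def)

text \<open>The constant sequence of empty sets is disjoint, and a convergent series with constant
  terms has zero terms.\<close>

lemma rcabv_empty:
  assumes "\<mu> \<in> rcabv"
  shows "\<mu> {} = 0"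
proof -
  have "(\<lambda>i::nat. \<mu> {}) sums \<mu> (\<Union>i::nat. {})"
    by (rule rcabv_sums[OF assms]) (auto simp: disjoint_family_on_def)
  then have "(\<lambda>i::nat. \<mu> {}) \<longlonglongrightarrow> 0" by (intro summable_LIMSEQ_zero sums_summable)
  then show ?thesis by (simp add: LIMSEQ_const_iff)
qed

lemma rcabv_Un:
  assumes "\<mu> \<in> rcabv" "A \<in> sets borel" "B \<in> sets borel" "A \<inter> B = {}"
  shows "\<mu> (A \<union> B) = \<mu> A + \<mu> B"
proof -
  have "(\<lambda>i. \<mu> (binaryset A B i)) sums \<mu> (\<Union>i. binaryset A B i)"
    using assms by (intro rcabv_sums) (auto simp: range_binaryset_eq disjoint_family_on_def
        binaryset_def)
  moreover have "(\<lambda>i. \<mu> (binaryset A B i)) sums (\<mu> A + \<mu> B)"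
    using rcabv_empty[OF assms(1)] by (rule binaryset_sums)
  ultimately show ?thesis by (simp add: UN_binaryset_eq sums_unique2)
qed

lemma rcabv_finite_UN:
  assumes "\<mu> \<in> rcabv" "finite I" "\<And>i. i \<in> I \<Longrightarrow> A i \<in> sets borel" "disjoint_family_on A I"
  shows "\<mu> (\<Union>i\<in>I. A i) = (\<Sum>i\<in>I. \<mu> (A i))"
  using assms(2-)
proof (induction I rule: finite_induct)
  case (insert i I)
  have "A i \<inter> A j = {}" if "j \<in> I" for j
    using disjoint_family_onD[OF insert.prems(2), of i j] insert.hyps that by auto
  then have "A i \<inter> (\<Union>j\<in>I. A j) = {}" by blast
  moreover have "(\<Union>j\<in>I. A j) \<in> sets borel" using insert by (intro sets.finite_UN) auto
  ultimately have "\<mu> (A i \<union> (\<Union>j\<in>I. A j)) = \<mu> (A i) + \<mu> (\<Union>j\<in>I. A j)"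
    using insert.prems by (intro rcabv_Un assms(1)) auto
  moreover have "disjoint_family_on A I"
    using insert.prems(2) by (rule disjoint_family_on_mono[rotated]) auto
  ultimately show ?case using insert by simp
qed (simp add: rcabv_empty[OF assms(1)])

text \<open>\<open>variation\<close> ranges over sets of cells, not families. Only the empty cell
  can repeat in a disjoint family, so it is dropped and the rest reindexed injectively.\<close>

lemma sum_norm_le_variation:
  assumes "\<mu> {} = 0" "finite I" "\<And>i. i \<in> I \<Longrightarrow> A i \<in> sets borel" "disjoint_family_on A I"
  shows "(\<Sum>i\<in>I. ennreal (norm (\<mu> (A i)))) \<le> variation \<mu> (\<Union>i\<in>I. A i)"
proof -
  let ?J = "{i \<in> I. A i \<noteq> {}}"
  have inj: "inj_on A ?J"
  proof (rule inj_onI, rule ccontr)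
    fix i j assume ij: "i \<in> ?J" "j \<in> ?J" "A i = A j" "i \<noteq> j"
    then have "A i \<inter> A j = {}" by (intro disjoint_family_onD[OF assms(4)]) auto
    with ij show False by simp
  qed
  have "(\<Sum>i\<in>I. ennreal (norm (\<mu> (A i)))) = (\<Sum>i\<in>?J. ennreal (norm (\<mu> (A i))))"
    using assms(1,2) by (intro sum.mono_neutral_right) auto
  also have "\<dots> = (\<Sum>B\<in>A ` ?J. ennreal (norm (\<mu> B)))"
    by (simp add: sum.reindex[OF inj])
  also have "\<dots> \<le> variation \<mu> (\<Union>i\<in>I. A i)"
    unfolding variation_def
  proof (rule SUP_upper)
    have "disjoint (A ` ?J)"
      using disjoint_family_on_mono[OF _ assms(4), of ?J]
      by (intro disjoint_family_on_disjoint_image) auto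
    moreover have "\<Union>(A ` ?J) = (\<Union>i\<in>I. A i)" by auto
    ultimately show "A ` ?J \<in> {P. finite P \<and> disjoint P \<and> P \<subseteq> sets borel \<and> \<Union>P = (\<Union>i\<in>I. A i)}"
      using assms(2,3) by auto
  qed
  finally show ?thesis .
qed

lemma norm_le_variation:
  assumes "A \<in> sets borel"
  shows "ennreal (norm (\<mu> A)) \<le> variation \<mu> A"
proof -
  have "(\<Sum>B\<in>{A}. ennreal (norm (\<mu> B))) \<le> variation \<mu> A"
    unfolding variation_def by (rule SUP_upper) (use assms in \<open>auto simp: disjoint_def\<close>)
  then show ?thesis by simp
qed

text \<open>Partitions must exhaust the set exactly, so a partition of \<open>A\<close> is completed
  by \<open>B - A\<close>.\<close>

lemma variation_mono:
  assumes "A \<subseteq> B" "A \<in> sets borel" "B \<in> sets borel"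
  shows "variation \<mu> A \<le> variation \<mu> B"
  unfolding variation_def[of \<mu> A]
proof (rule SUP_least)
  fix P :: "'a set set"
  assume "P \<in> {P. finite P \<and> disjoint P \<and> P \<subseteq> sets borel \<and> \<Union>P = A}"
  then have P: "finite P" "disjoint P" "P \<subseteq> sets borel" "\<Union>P = A" by auto
  have "(\<Sum>C\<in>P. ennreal (norm (\<mu> C))) \<le> (\<Sum>C\<in>insert (B - A) P. ennreal (norm (\<mu> C)))"
    using P(1) by (intro sum_mono2) auto
  also have "\<dots> \<le> variation \<mu> B"
    unfolding variation_def
  proof (rule SUP_upper)
    have "disjoint (insert (B - A) P)"
      using P(2,4) unfolding disjoint_def by blast
    then show "insert (B - A) P \<in> {P. finite P \<and> disjoint P \<and> P \<subseteq> sets borel \<and> \<Union>P = B}"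
      using P assms by auto
  qed
  finally show "(\<Sum>C\<in>P. ennreal (norm (\<mu> C))) \<le> variation \<mu> B" .
qed

lemma variation_Un_le:
  assumes \<mu>: "\<mu> \<in> rcabv" and A: "A \<in> sets borel" and B: "B \<in> sets borel" and "A \<inter> B = {}"
  shows "variation \<mu> (A \<union> B) \<le> variation \<mu> A + variation \<mu> B"
  unfolding variation_def[of \<mu> "A \<union> B"]
proof (rule SUP_least)
  fix P :: "'a set set"
  assume "P \<in> {P. finite P \<and> disjoint P \<and> P \<subseteq> sets borel \<and> \<Union>P = A \<union> B}"
  then have P: "finite P" "disjoint P" "P \<subseteq> sets borel" "\<Union>P = A \<union> B" by auto
  have part: "(\<Sum>C\<in>P. ennreal (norm (\<mu> (C \<inter> D)))) \<le> variation \<mu> D" if "D \<in> sets borel" "D \<subseteq> A \<union> B"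
      for D
  proof -
    have "(\<Sum>C\<in>P. ennreal (norm (\<mu> (C \<inter> D)))) \<le> variation \<mu> (\<Union>C\<in>P. C \<inter> D)"
      using P that by (intro sum_norm_le_variation rcabv_empty[OF \<mu>])
        (auto simp: disjoint_family_on_def disjoint_def)
    also have "(\<Union>C\<in>P. C \<inter> D) = D" using P(4) that(2) by blast
    finally show ?thesis .
  qed
  have "ennreal (norm (\<mu> C)) \<le> ennreal (norm (\<mu> (C \<inter> A))) + ennreal (norm (\<mu> (C \<inter> B)))" if "C \<in> P"
      for C
  proof -
    have "(C \<inter> A) \<union> (C \<inter> B) = C" using P(4) that by blast
    then have "\<mu> C = \<mu> (C \<inter> A) + \<mu> (C \<inter> B)"
      using rcabv_Un[OF \<mu>, of "C \<inter> A" "C \<inter> B"] P(3) that A B assms(4) by (auto simp: disjoint_iff)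
    then show ?thesis by (simp add: norm_triangle_ineq flip: ennreal_plus)
  qed
  then have "(\<Sum>C\<in>P. ennreal (norm (\<mu> C))) \<le>
      (\<Sum>C\<in>P. ennreal (norm (\<mu> (C \<inter> A))) + ennreal (norm (\<mu> (C \<inter> B))))"
    by (intro sum_mono)
  also have "\<dots> \<le> variation \<mu> A + variation \<mu> B"
    unfolding sum.distrib using part[OF A] part[OF B] by (intro add_mono) auto
  finally show "(\<Sum>C\<in>P. ennreal (norm (\<mu> C))) \<le> variation \<mu> A + variation \<mu> B" .
qed

lemma variation_cong:
  assumes "\<And>A. A \<in> sets borel \<Longrightarrow> \<mu> A = \<nu> A"
  shows "variation \<mu> E = variation \<nu> E"
  unfolding variation_def using assms
  by (intro SUP_cong sum.cong refl arg_cong[where f="\<lambda>x. ennreal (norm x)"]) auto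

text \<open>Additivity spreads \<open>\<mu> E\<close> over the level sets of \<open>s\<close>, so
  that only \<open>v - x\<close> is paired with each piece. The bound on \<open>v - x\<close> is
  known only for values taken on \<open>E\<close>; the other level sets meet \<open>E\<close> in the
  empty set.\<close>

lemma simple_sum_estimate:
  fixes \<mu> :: "'k::topological_space set \<Rightarrow> 'x::real_normed_vector dual"
  assumes \<mu>: "\<mu> \<in> rcabv" and s: "simple_function borel s" and E: "E \<in> sets borel"
    and c: "variation \<mu> E \<le> ennreal c" "0 \<le> c"
    and d: "\<And>t. t \<in> E \<Longrightarrow> norm (s t - x) \<le> d" "0 \<le> d"
  shows "\<bar>(\<Sum>v\<in>range s. blinfun_apply (\<mu> (s -` {v} \<inter> E)) v) - blinfun_apply (\<mu> E) x\<bar> \<le> c * d"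
proof -
  let ?B = "\<lambda>v. s -` {v} \<inter> E"
  have fin: "finite (range s)" using simple_functionD(1)[OF s] by simp
  have B: "?B v \<in> sets borel" for v using simple_functionD(2)[OF s, of "{v}"] E by simp
  have disj: "disjoint_family_on ?B (range s)" by (auto simp: disjoint_family_on_def)
  have UN: "(\<Union>v\<in>range s. ?B v) = E" by auto
  have "\<mu> E = (\<Sum>v\<in>range s. \<mu> (?B v))"
    using rcabv_finite_UN[OF \<mu> fin B disj] UN by simp
  then have "(\<Sum>v\<in>range s. blinfun_apply (\<mu> (?B v)) v) - blinfun_apply (\<mu> E) x =
      (\<Sum>v\<in>range s. blinfun_apply (\<mu> (?B v)) (v - x))"
    by (simp add: blinfun.sum_left blinfun.diff_right sum_subtractf)
  also have "\<bar>\<dots>\<bar> \<le> (\<Sum>v\<in>range s. norm (\<mu> (?B v)) * d)"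
    unfolding real_norm_def[symmetric]
  proof (rule sum_norm_le)
    fix v
    show "norm (blinfun_apply (\<mu> (?B v)) (v - x)) \<le> norm (\<mu> (?B v)) * d"
    proof (cases "?B v = {}")
      case True
      then show ?thesis by (simp only: rcabv_empty[OF \<mu>]) simp
    next
      case False
      then have "norm (v - x) \<le> d" using d(1) by auto
      then show ?thesis by (intro order_trans[OF norm_blinfun] mult_left_mono) auto
    qed
  qed
  also have "\<dots> = (\<Sum>v\<in>range s. norm (\<mu> (?B v))) * d" by (simp add: sum_distrib_right)
  also have "\<dots> \<le> c * d"
  proof (rule mult_right_mono[OF _ d(2)])
    have "ennreal (\<Sum>v\<in>range s. norm (\<mu> (?B v))) \<le> ennreal c"
      using sum_norm_le_variation[where A="?B" and \<mu>=\<mu>, OF rcabv_empty[OF \<mu>] fin B disj] c(1)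
      unfolding UN by (simp add: order_trans)
    then show "(\<Sum>v\<in>range s. norm (\<mu> (?B v))) \<le> c" using c(2) by (simp add: ennreal_le_iff)
  qed
  finally show ?thesis .
qed

text \<open>A Riemann sum estimate in which a cell is harmless for either of two reasons: little
  variation (\<open>c j\<close> small) or little oscillation (\<open>d j\<close> small). It is used
  with cells of both kinds.\<close>

lemma has_integral_vm_partition_estimate:
  fixes \<mu> :: "'k::topological_space set \<Rightarrow> 'x::real_normed_vector dual"
  assumes \<mu>: "\<mu> \<in> rcabv" and int: "has_integral_vm \<mu> f i" and J: "finite J"
    and E: "\<And>j. j \<in> J \<Longrightarrow> E j \<in> sets borel" "disjoint_family_on E J" "(\<Union>j\<in>J. E j) = UNIV"
    and c: "\<And>j. j \<in> J \<Longrightarrow> variation \<mu> (E j) \<le> ennreal (c j)" "\<And>j. j \<in> J \<Longrightarrow> 0 \<le> c j"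
    and d: "\<And>j t. j \<in> J \<Longrightarrow> t \<in> E j \<Longrightarrow> norm (f t - x j) \<le> d j" "\<And>j. j \<in> J \<Longrightarrow> 0 \<le> d j"
  shows "\<bar>i - (\<Sum>j\<in>J. blinfun_apply (\<mu> (E j)) (x j))\<bar> \<le> (\<Sum>j\<in>J. c j * d j)"
proof -
  obtain s where s: "\<And>n. simple_function borel (s n)" "uniform_limit UNIV s f sequentially"
    "(\<lambda>n. simple_integral_vm \<mu> (s n)) \<longlonglongrightarrow> i"
    using int unfolding has_integral_vm_def by blast
  let ?S = "\<Sum>j\<in>J. blinfun_apply (\<mu> (E j)) (x j)"
  \<comment> \<open>\<open>e\<close> bounds the uniform distance from a simple function to
    \<open>f\<close> and is sent to \<open>0\<close> at the end.\<close>
  have est: "\<bar>i - ?S\<bar> \<le> (\<Sum>j\<in>J. c j * (d j + e))" if "0 < e" for e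
  proof (rule tendsto_upperbound)
    show "(\<lambda>n. \<bar>simple_integral_vm \<mu> (s n) - ?S\<bar>) \<longlonglongrightarrow> \<bar>i - ?S\<bar>"
      by (intro tendsto_intros s)
    show "\<forall>\<^sub>F n in sequentially. \<bar>simple_integral_vm \<mu> (s n) - ?S\<bar> \<le> (\<Sum>j\<in>J. c j * (d j + e))"
      using uniform_limitD[OF s(2) that]
    proof eventually_elim
      case (elim n)
      have preim: "s n -` {v} \<in> sets borel" for v
        using simple_functionD(2)[OF s(1), of n "{v}"] by simp
      have "\<mu> (s n -` {v}) = (\<Sum>j\<in>J. \<mu> (s n -` {v} \<inter> E j))" for v
      proof -
        have "(\<Union>j\<in>J. s n -` {v} \<inter> E j) = s n -` {v}" using E(3) by blast
        moreover have "disjoint_family_on (\<lambda>j. s n -` {v} \<inter> E j) J"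
          using E(2) unfolding disjoint_family_on_def by blast
        ultimately show ?thesis
          using rcabv_finite_UN[OF \<mu> J, of "\<lambda>j. s n -` {v} \<inter> E j"] E(1) preim by simp
      qed
      then have "simple_integral_vm \<mu> (s n) =
          (\<Sum>v\<in>range (s n). \<Sum>j\<in>J. blinfun_apply (\<mu> (s n -` {v} \<inter> E j)) v)"
        by (simp add: simple_integral_vm_def blinfun.sum_left)
      also have "\<dots> = (\<Sum>j\<in>J. \<Sum>v\<in>range (s n). blinfun_apply (\<mu> (s n -` {v} \<inter> E j)) v)"
        by (rule sum.swap)
      finally have "simple_integral_vm \<mu> (s n) - ?S =
          (\<Sum>j\<in>J. (\<Sum>v\<in>range (s n). blinfun_apply (\<mu> (s n -` {v} \<inter> E j)) v) -
            blinfun_apply (\<mu> (E j)) (x j))"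
        by (simp add: sum_subtractf)
      also have "\<bar>\<dots>\<bar> \<le> (\<Sum>j\<in>J. c j * (d j + e))"
        unfolding real_norm_def[symmetric]
      proof (rule sum_norm_le)
        fix j assume j: "j \<in> J"
        have "norm (s n t - x j) \<le> d j + e" if "t \<in> E j" for t
        proof -
          have "norm ((s n t - f t) + (f t - x j)) \<le> e + d j"
            using elim d(1)[OF j that] by (intro norm_triangle_mono) (auto simp: dist_norm
            less_imp_le)
          then show ?thesis by (simp add: add.commute)
        qed
        then show "norm ((\<Sum>v\<in>range (s n). blinfun_apply (\<mu> (s n -` {v} \<inter> E j)) v) -
            blinfun_apply (\<mu> (E j)) (x j)) \<le> c j * (d j + e)"
          unfolding real_norm_def using j d(2)[OF j] \<open>0 < e\<close>
          by (intro simple_sum_estimate[OF \<mu> s(1)] E c) auto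
      qed
      finally show ?case .
    qed
  qed simp
  show ?thesis
  proof (rule tendsto_lowerbound)
    show "((\<lambda>e. \<Sum>j\<in>J. c j * (d j + e)) \<longlongrightarrow> (\<Sum>j\<in>J. c j * d j)) (at_right 0)"
      by (auto intro!: tendsto_eq_intros)
    show "\<forall>\<^sub>F e in at_right 0. \<bar>i - ?S\<bar> \<le> (\<Sum>j\<in>J. c j * (d j + e))"
      using est by (auto intro: eventually_mono[OF eventually_at_right_less])
  qed simp
qed

text \<open>On \<open>C\<close> and off \<open>U\<close> the function \<open>h\<close> is exact, so
  only \<open>U - C\<close> costs \<open>e * norm x\<close>. The second \<open>e\<close> pays for
  replacing \<open>C\<close> by \<open>A\<close>.\<close>

lemma has_integral_vm_urysohn_estimate:
  fixes \<mu> :: "'k::t2_space set \<Rightarrow> 'x::real_normed_vector dual"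
  assumes \<mu>: "\<mu> \<in> rcabv" and int: "has_integral_vm \<mu> (apply_bcontfun (bcontfun_scale h
      (const_bcontfun x))) i"
    and CU: "C \<in> sets borel" "U \<in> sets borel" "C \<subseteq> A" "A \<subseteq> U" "A \<in> sets borel"
    and e: "variation \<mu> (U - C) \<le> ennreal e" "0 \<le> e"
    and h: "\<And>t. 0 \<le> apply_bcontfun h t" "\<And>t. apply_bcontfun h t \<le> 1"
      "\<And>t. t \<in> C \<Longrightarrow> apply_bcontfun h t = 1" "\<And>t. t \<notin> U \<Longrightarrow> apply_bcontfun h t = 0"
  shows "\<bar>i - blinfun_apply (\<mu> A) x\<bar> \<le> 2 * e * norm x"
proof -
  obtain V where V: "0 \<le> V" "variation \<mu> UNIV = ennreal V"
    using \<mu> unfolding rcabv_def by (cases "variation \<mu> UNIV") auto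
  let ?E = "\<lambda>j::nat. if j = 0 then C else if j = 1 then U - C else - U"
  let ?c = "\<lambda>j::nat. if j = 1 then e else V"
  let ?x = "\<lambda>j::nat. if j = 0 then x else 0"
  let ?d = "\<lambda>j::nat. if j = 1 then norm x else 0"
  have E: "?E j \<in> sets borel" for j using CU by auto
  have "\<bar>i - (\<Sum>j<3. blinfun_apply (\<mu> (?E j)) (?x j))\<bar> \<le> (\<Sum>j<3. ?c j * ?d j)"
  proof (rule has_integral_vm_partition_estimate[OF \<mu> int])
    show "disjoint_family_on ?E {..<3}"
      using CU(3,4) by (auto simp: disjoint_family_on_def)
    have "t \<in> (\<Union>j\<in>{0,1,2}. ?E j)" for t by auto
    moreover have "{..<3} = {0,1,2::nat}" by auto
    ultimately show "(\<Union>j<3. ?E j) = UNIV" by auto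
    show "variation \<mu> (?E j) \<le> ennreal (?c j)" for j
      using e V(2) variation_mono[of "?E j" UNIV \<mu>] E[of j] by (cases "j = 1") auto
    show "norm (bcontfun_scale h (const_bcontfun x) t - ?x j) \<le> ?d j" if "t \<in> ?E j" for j t
      using that h(1)[of t] h(2)[of t] h(3)[of t] h(4)[of t]
      by (auto simp: const_bcontfun.rep_eq mult_left_le_one_le split: if_splits)
  qed (use E e V in auto)
  then have 1: "\<bar>i - blinfun_apply (\<mu> C) x\<bar> \<le> e * norm x"
    by (simp add: numeral_3_eq_3 blinfun.zero_right)
  have "C \<union> (A - C) = A" using CU by blast
  then have "\<mu> A = \<mu> C + \<mu> (A - C)"
    using rcabv_Un[OF \<mu>, of C "A - C"] CU by auto
  moreover have "norm (\<mu> (A - C)) \<le> e"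
  proof -
    have "ennreal (norm (\<mu> (A - C))) \<le> variation \<mu> (A - C)" using CU
        by (intro norm_le_variation) auto
    also have "\<dots> \<le> variation \<mu> (U - C)" using CU by (intro variation_mono) auto
    finally show ?thesis using e by (metis ennreal_le_iff order_trans)
  qed
  then have "norm (blinfun_apply (\<mu> (A - C)) x) \<le> e * norm x"
    using norm_blinfun[of "\<mu> (A - C)" x] by (metis mult_right_mono norm_ge_zero order_trans)
  ultimately show ?thesis using 1 by (simp add: blinfun.add_left)
qed

text \<open>Regularity gives a pair of sets for each measure; finiteness of \<open>M\<close> keeps
  the union of the inner sets closed and the intersection of the outer sets open. Several measures
  must share \<open>h\<close> for uniqueness and linearity.\<close>

lemma rcabv_common_urysohn:
  fixes M :: "('k::t2_space set \<Rightarrow> 'x::real_normed_vector dual) set"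
  assumes K: "compact (UNIV :: 'k set)" and M: "finite M"
      "M \<subseteq> rcabv" and A: "A \<in> sets borel" and e: "0 < e"
  shows "\<exists>h :: 'k \<Rightarrow>\<^sub>C real. (\<forall>t. 0 \<le> apply_bcontfun h t) \<and> (\<forall>t. apply_bcontfun h t \<le> 1) \<and>
    (\<forall>\<mu>\<in>M. \<forall>x i. has_integral_vm \<mu> (apply_bcontfun (bcontfun_scale h (const_bcontfun x))) i \<longrightarrow>
      \<bar>i - blinfun_apply (\<mu> A) x\<bar> \<le> e * norm x)"
proof -
  have "\<forall>\<mu>\<in>M. \<exists>C U. compact C \<and> open U \<and> C \<subseteq> A \<and> A \<subseteq> U \<and> variation \<mu> (U - C) < ennreal (e / 2)"
    using M(2) A e by (auto simp: rcabv_def subset_iff)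
  then obtain C U where CU: "\<And>\<mu>. \<mu> \<in> M \<Longrightarrow> compact (C \<mu>) \<and> open (U \<mu>) \<and> C \<mu> \<subseteq> A \<and> A \<subseteq> U \<mu> \<and>
      variation \<mu> (U \<mu> - C \<mu>) < ennreal (e / 2)" by metis
  let ?C = "\<Union>\<mu>\<in>M. C \<mu>" and ?U = "\<Inter>\<mu>\<in>M. U \<mu>"
  have "closed ?C" using CU M(1) by (intro closed_UN ballI compact_imp_closed) auto
  moreover have "open ?U" using CU M(1) by (intro open_INT) auto
  moreover have sub: "?C \<subseteq> A" "A \<subseteq> ?U" using CU by blast+
  ultimately obtain h :: "'k \<Rightarrow>\<^sub>C real" where h: "\<forall>t. 0 \<le> apply_bcontfun h t" "\<forall>t. h t \<le> 1"
      "\<forall>t\<in>?C. h t = 1" "\<forall>t\<in>- ?U. h t = 0"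
    using compact_urysohn[OF K, of ?C "- ?U"] by blast
  have "\<bar>i - blinfun_apply (\<mu> A) x\<bar> \<le> e * norm x"
    if \<mu>: "\<mu> \<in> M" and int: "has_integral_vm \<mu> (apply_bcontfun (bcontfun_scale h (const_bcontfun
        x))) i" for \<mu> x i
  proof -
    have "?C \<in> sets borel" "?U \<in> sets borel" using \<open>closed ?C\<close> \<open>open ?U\<close> by auto
    moreover have "variation \<mu> (?U - ?C) \<le> variation \<mu> (U \<mu> - C \<mu>)"
      using \<mu> CU[OF \<mu>] calculation by (intro variation_mono sets.Diff) (auto intro:
          borel_closed[OF compact_imp_closed])
    then have "variation \<mu> (?U - ?C) \<le> ennreal (e / 2)" using CU[OF \<mu>]
        by (meson less_imp_le order_trans)
    ultimately have "\<bar>i - blinfun_apply (\<mu> A) x\<bar> \<le> 2 * (e / 2) * norm x"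
      using sub A h e M(2) \<mu> by (intro has_integral_vm_urysohn_estimate[OF _ int, of ?C ?U]) auto
    then show ?thesis by simp
  qed
  then show ?thesis using h by blast
qed

section \<open>Uniqueness of the measure and linearity in the functional\<close>

definition represents ::
    "('k::topological_space set \<Rightarrow> 'x::real_normed_vector dual) \<Rightarrow> ('k \<Rightarrow>\<^sub>C 'x) dual \<Rightarrow> bool"
  where "represents \<mu> \<phi> \<longleftrightarrow> \<mu> \<in> rcabv \<and> (\<forall>f. has_integral_vm \<mu> (apply_bcontfun f) (blinfun_apply \<phi>
      f))"

lemma represents_common_urysohn:
  fixes P :: "(('k::t2_space set \<Rightarrow> 'x::real_normed_vector dual) \<times> ('k \<Rightarrow>\<^sub>C 'x) dual) set"
  assumes K: "compact (UNIV :: 'k set)" and P: "finite P" "\<And>\<mu> \<phi>. (\<mu>, \<phi>) \<in> P \<Longrightarrow> represents \<mu> \<phi>"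
    and A: "A \<in> sets borel" and e: "0 < e"
  shows "\<exists>h :: 'k \<Rightarrow>\<^sub>C real. (\<forall>f :: 'k \<Rightarrow>\<^sub>C 'x. norm (bcontfun_scale h f) \<le> norm f) \<and>
    (\<forall>(\<mu>, \<phi>)\<in>P. \<forall>x. \<bar>blinfun_apply \<phi> (bcontfun_scale h (const_bcontfun x)) -
        blinfun_apply (\<mu> A) x\<bar> \<le> e * norm x)"
proof -
  have "finite (fst ` P)" "fst ` P \<subseteq> rcabv" using P by (auto simp: represents_def)
  from rcabv_common_urysohn[OF K this A e] obtain h :: "'k \<Rightarrow>\<^sub>C real"
    where h: "\<forall>t. 0 \<le> apply_bcontfun h t" "\<forall>t. apply_bcontfun h t \<le> 1"
      "\<forall>\<mu>\<in>fst ` P. \<forall>x i. has_integral_vm \<mu> (apply_bcontfun (bcontfun_scale h (const_bcontfun x)))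
          i \<longrightarrow>
      \<bar>i - blinfun_apply (\<mu> A) x\<bar> \<le> e * norm x" by blast
  have "norm (bcontfun_scale h f) \<le> norm f" for f :: "'k \<Rightarrow>\<^sub>C 'x"
    using h by (intro norm_bcontfun_scale_le) auto
  moreover have "\<bar>blinfun_apply \<phi> (bcontfun_scale h (const_bcontfun x)) - blinfun_apply (\<mu> A) x\<bar> \<le>
      e * norm x"
    if "(\<mu>, \<phi>) \<in> P" for \<mu> \<phi> x
  proof -
    have "\<mu> \<in> fst ` P" "represents \<mu> \<phi>" using that P(2) by force+
    then show ?thesis using h(3) unfolding represents_def by blast
  qed
  ultimately show ?thesis by blast
qed

lemma abs_le_all_eps_imp_zero:
  fixes a c :: real
  assumes "\<And>e. 0 < e \<Longrightarrow> \<bar>a\<bar> \<le> e * c" "0 \<le> c"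
  shows "a = 0"
proof (rule ccontr)
  assume "a \<noteq> 0"
  then have "\<bar>a\<bar> \<le> (\<bar>a\<bar> / (2 * (c + 1))) * c" using assms by (intro assms(1)) simp
  also have "\<dots> < \<bar>a\<bar>" using \<open>a \<noteq> 0\<close> assms(2) by (simp add: field_simps add_nonneg_pos)
  finally show False by simp
qed

text \<open>With \<open>h\<close> common to both measures, the single number
  \<open>\<phi>(h x)\<close> approximates both \<open>\<mu> A x\<close> and
  \<open>\<nu> A x\<close>.\<close>

lemma represents_unique:
  fixes \<mu> :: "'k::t2_space set \<Rightarrow> 'x::real_normed_vector dual"
  assumes K: "compact (UNIV :: 'k set)" and "represents \<mu> \<phi>" "represents \<nu> \<phi>" "A \<in> sets borel"
  shows "\<mu> A = \<nu> A"
proof (rule blinfun_eqI)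
  fix x
  have "\<bar>blinfun_apply (\<mu> A) x - blinfun_apply (\<nu> A) x\<bar> \<le> e * (2 * norm x)" if "0 < e" for e
  proof -
    from represents_common_urysohn[OF K, of "{(\<mu>, \<phi>), (\<nu>, \<phi>)}" A e] assms that
    obtain h where "\<bar>blinfun_apply \<phi> (bcontfun_scale h (const_bcontfun x)) -
        blinfun_apply (\<mu> A) x\<bar> \<le> e * norm x"
      "\<bar>blinfun_apply \<phi> (bcontfun_scale h (const_bcontfun x)) - blinfun_apply (\<nu> A) x\<bar> \<le> e * norm x"
      by auto
    then show ?thesis by simp
  qed
  then have "blinfun_apply (\<mu> A) x - blinfun_apply (\<nu> A) x = 0"
    by (rule abs_le_all_eps_imp_zero) simp_all
  then show "blinfun_apply (\<mu> A) x = blinfun_apply (\<nu> A) x" by simp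
qed

lemma represents_measure_of_functional:
  fixes \<phi> :: "('k::t2_space \<Rightarrow>\<^sub>C 'x::real_normed_vector) dual"
  assumes "compact (UNIV :: 'k set)" "dispersed (UNIV :: 'k set)"
  shows "represents (measure_of_functional \<phi>) \<phi>"
proof -
  have "\<exists>\<mu>. \<mu> \<in> rcabv \<and> (\<forall>f. has_integral_vm \<mu> (apply_bcontfun f) (blinfun_apply \<phi> f))"
    using dispersed_representing_measure[OF assms, of \<phi>] by metis
  then show ?thesis
    unfolding represents_def measure_of_functional_def by (rule someI_ex)
qed

text \<open>The chosen measure agrees with the constructed one on Borel sets, and only those enter
  \<open>variation\<close>.\<close>

lemma measure_of_functional_atomic:
  fixes \<phi> :: "('k::t2_space \<Rightarrow>\<^sub>C 'x::real_normed_vector) dual"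
  assumes "compact (UNIV :: 'k set)" "dispersed (UNIV :: 'k set)" "0 < e"
  shows "\<exists>F. finite F \<and> variation (measure_of_functional \<phi>) (- F) \<le> ennreal e"
proof -
  obtain \<mu> where \<mu>: "represents \<mu> \<phi>" "\<And>\<epsilon>. 0 < \<epsilon> \<Longrightarrow> \<exists>F. finite F \<and> variation \<mu> (- F) \<le> ennreal \<epsilon>"
    using dispersed_representing_measure[OF assms(1,2), of \<phi>] unfolding represents_def by metis
  have "variation (measure_of_functional \<phi>) E = variation \<mu> E" for E
    using represents_unique[OF assms(1) represents_measure_of_functional[OF assms(1,2)] \<mu>(1)]
    by (intro variation_cong)
  then show ?thesis using \<mu>(2)[OF assms(3)] by simp
qed

text \<open>\<open>Blinfun\<close> returns its argument only if that is bounded and linear, which is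
  not evident for a map built from choices. It is a limit of evaluations
  \<open>\<phi> \<mapsto> \<phi>(h x)\<close>, which are linear and bounded by
  \<open>norm x\<close>.\<close>

lemma indicator_bidual_apply:
  fixes x :: "'x::real_normed_vector"
  assumes K: "compact (UNIV :: 'k::t2_space set)" and disp: "dispersed (UNIV :: 'k set)"
    and A: "(A :: 'k set) \<in> sets borel"
  shows "blinfun_apply (indicator_bidual A x) \<phi> = blinfun_apply (measure_of_functional \<phi> A) x"
proof -
  let ?m = "\<lambda>\<phi> :: ('k \<Rightarrow>\<^sub>C 'x) dual. blinfun_apply (measure_of_functional \<phi> A) x"
  have rep: "represents (measure_of_functional \<phi>) \<phi>" for \<phi> :: "('k \<Rightarrow>\<^sub>C 'x) dual"
    using K disp by (rule represents_measure_of_functional)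
  have ury: "\<exists>h :: 'k \<Rightarrow>\<^sub>C real. norm (bcontfun_scale h (const_bcontfun x)) \<le> norm x \<and>
      (\<forall>\<phi>\<in>\<Phi>. \<bar>blinfun_apply \<phi> (bcontfun_scale h (const_bcontfun x)) - ?m \<phi>\<bar> \<le> e * norm x)"
    if "finite \<Phi>" "0 < e" for \<Phi> e
  proof -
    let ?P = "(\<lambda>\<phi>. (measure_of_functional \<phi>, \<phi>)) ` \<Phi>"
    have P: "finite ?P" "\<And>\<mu> \<phi>. (\<mu>, \<phi>) \<in> ?P \<Longrightarrow> represents \<mu> \<phi>" using that(1) rep by auto
    from represents_common_urysohn[OF K P A that(2)] obtain h :: "'k \<Rightarrow>\<^sub>C real"
      where h: "\<forall>f :: 'k \<Rightarrow>\<^sub>C 'x. norm (bcontfun_scale h f) \<le> norm f"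
      "\<forall>(\<mu>, \<phi>)\<in>?P. \<forall>x. \<bar>blinfun_apply \<phi> (bcontfun_scale h (const_bcontfun x)) -
          blinfun_apply (\<mu> A) x\<bar> \<le> e * norm x"
      by blast
    have "norm (const_bcontfun x :: 'k \<Rightarrow>\<^sub>C 'x) \<le> norm x"
      by (rule norm_bound) (simp add: const_bcontfun.rep_eq)
    then have "norm (bcontfun_scale h (const_bcontfun x)) \<le> norm x" using h(1) order_trans by blast
    then show ?thesis using h(2) by auto
  qed
  have "bounded_linear ?m"
  proof (rule bounded_linear_intro)
    fix \<phi> \<psi> :: "('k \<Rightarrow>\<^sub>C 'x) dual" and c :: real
    \<comment> \<open>Three measures are compared through the same \<open>h\<close>, each with error
      \<open>e * norm x\<close>.\<close>
    have "\<bar>?m (\<phi> + \<psi>) - (?m \<phi> + ?m \<psi>)\<bar> \<le> e * (3 * norm x)" if e: "0 < e" for e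
      using ury[of "{\<phi>, \<psi>, \<phi> + \<psi>}", OF _ e] by (force simp: blinfun.add_left)
    then have "?m (\<phi> + \<psi>) - (?m \<phi> + ?m \<psi>) = 0" by (rule abs_le_all_eps_imp_zero) simp_all
    then show "?m (\<phi> + \<psi>) = ?m \<phi> + ?m \<psi>" by simp
    have "\<bar>?m (c *\<^sub>R \<phi>) - c * ?m \<phi>\<bar> \<le> e * ((1 + \<bar>c\<bar>) * norm x)" if e: "0 < e" for e
    proof -
      obtain h where h: "\<bar>blinfun_apply \<phi> (bcontfun_scale h (const_bcontfun x)) - ?m \<phi>\<bar> \<le>
          e * norm x"
        "\<bar>c * blinfun_apply \<phi> (bcontfun_scale h (const_bcontfun x)) - ?m (c *\<^sub>R \<phi>)\<bar> \<le> e * norm x"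
        using ury[of "{\<phi>, c *\<^sub>R \<phi>}", OF _ e] by (auto simp: blinfun.scaleR_left)
      have "\<bar>c * blinfun_apply \<phi> (bcontfun_scale h (const_bcontfun x)) - c * ?m \<phi>\<bar> \<le>
          \<bar>c\<bar> * (e * norm x)"
        using h(1) by (simp add: abs_mult mult_left_mono flip: right_diff_distrib)
      with h(2) show ?thesis by (simp add: algebra_simps)
    qed
    then have "?m (c *\<^sub>R \<phi>) - c * ?m \<phi> = 0" by (rule abs_le_all_eps_imp_zero) simp_all
    then show "?m (c *\<^sub>R \<phi>) = c *\<^sub>R ?m \<phi>" by simp
    show "norm (?m \<phi>) \<le> norm \<phi> * norm x"
    proof (rule field_le_epsilon)
      fix e :: real assume e: "0 < e"
      then have "0 < e / (norm x + 1)" by (simp add: add_nonneg_pos)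
      from ury[of "{\<phi>}", OF _ this] obtain h where h: "norm (bcontfun_scale h (const_bcontfun x))
          \<le> norm x"
        "\<bar>blinfun_apply \<phi> (bcontfun_scale h (const_bcontfun x)) - ?m \<phi>\<bar> \<le> e / (norm x + 1) * norm x"
        by auto
      have "0 < norm x + 1" by (simp add: add_nonneg_pos)
      then have "e / (norm x + 1) * norm x \<le> e" using e by (simp add: field_simps)
      then show "norm (?m \<phi>) \<le> norm \<phi> * norm x + e"
        using functional_le[OF h(1), of \<phi>] h(2) by (simp add: abs_le_iff)
    qed
  qed
  then show ?thesis by (simp add: indicator_bidual_def bounded_linear_Blinfun_apply)
qed

section \<open>Uniform atomicity of strongly bounded representing measures\<close>

text \<open>The second adjoint evaluates \<open>\<chi>_A x\<close> at the adjoint image of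
  \<open>\<psi>\<close>, which is \<open>\<psi>\<close> composed with \<open>T\<close>; results on
  single functionals thus apply to \<open>m\<close>.\<close>

lemma representing_measure_apply:
  fixes T :: "('k::t2_space \<Rightarrow>\<^sub>C 'x::real_normed_vector) \<Rightarrow>\<^sub>L 'y::real_normed_vector"
  assumes "compact (UNIV :: 'k set)" "dispersed (UNIV :: 'k set)" "representing_measure m T"
      "A \<in> sets borel"
  shows "blinfun_apply (blinfun_apply (m A) x) \<psi> =
      blinfun_apply (measure_of_functional (\<psi> o\<^sub>L T) A) x"
  using assms by (simp add: representing_measure_def adjoint.rep_eq indicator_bidual_apply)

lemma functional_measure_eq:
  fixes T :: "('k::t2_space \<Rightarrow>\<^sub>C 'x::real_normed_vector) \<Rightarrow>\<^sub>L 'y::real_normed_vector"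
  assumes "compact (UNIV :: 'k set)" "dispersed (UNIV :: 'k set)" "representing_measure m T"
      "A \<in> sets borel"
  shows "functional_measure \<psi> m A = measure_of_functional (\<psi> o\<^sub>L T) A"
  by (rule blinfun_eqI) (simp add: functional_measure_def representing_measure_apply[OF assms])

lemma variation_functional_measure:
  fixes T :: "('k::t2_space \<Rightarrow>\<^sub>C 'x::real_normed_vector) \<Rightarrow>\<^sub>L 'y::real_normed_vector"
  assumes "compact (UNIV :: 'k set)" "dispersed (UNIV :: 'k set)" "representing_measure m T"
  shows "variation (functional_measure \<psi> m) E = variation (measure_of_functional (\<psi> o\<^sub>L T)) E"
  using functional_measure_eq[OF assms] by (rule variation_cong)

lemma variation_le_semivariation:
  "norm \<psi> \<le> 1 \<Longrightarrow> variation (functional_measure \<psi> m) E \<le> semivariation m E"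
  unfolding semivariation_def by (rule SUP_upper) simp

lemma semivariation_mono:
  assumes "A \<subseteq> B" "A \<in> sets borel" "B \<in> sets borel"
  shows "semivariation m A \<le> semivariation m B"
  unfolding semivariation_def using variation_mono[OF assms] by (intro SUP_mono) blast

lemma countable_in_borel: "countable A \<Longrightarrow> (A :: 'a::t1_space set) \<in> sets borel"
  by (rule sets.countable) auto

text \<open>Otherwise one could successively pick disjoint finite sets of semivariation bounded below; the
  tails of their union decrease to the empty set.\<close>

lemma strongly_bounded_uniformly_atomic:
  fixes T :: "('k::t2_space \<Rightarrow>\<^sub>C 'x::real_normed_vector) \<Rightarrow>\<^sub>L 'y::real_normed_vector"
  assumes K: "compact (UNIV :: 'k set)" and disp: "dispersed (UNIV :: 'k set)"
    and m: "representing_measure m T" and sb: "strongly_bounded m" and e: "0 < e"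
  shows "\<exists>F. finite F \<and> semivariation m (- F) \<le> ennreal e"
proof (rule ccontr)
  assume "\<not> ?thesis"
  then have big: "ennreal e < semivariation m (- F)" if "finite F" for F
    using that by (meson not_le)
  have step: "\<exists>G. finite G \<and> F \<subseteq> G \<and> ennreal (e / 2) < semivariation m (G - F)" if F: "finite F"
      for F
  proof -
    obtain \<psi> where \<psi>: "norm \<psi> \<le> 1" "ennreal e < variation (functional_measure \<psi> m) (- F)"
      using big[OF F] unfolding semivariation_def less_SUP_iff by blast
    let ?\<mu> = "measure_of_functional (\<psi> o\<^sub>L T)"
    have rc: "?\<mu> \<in> rcabv" using represents_measure_of_functional[OF K disp, of "\<psi> o\<^sub>L T"]
        by (simp add: represents_def)
    \<comment> \<open>The measure of this one \<open>\<psi>\<close> is itself atomic: all but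
      \<open>e / 2\<close> of its variation sits on a finite \<open>H\<close>, so
      \<open>H - F\<close> carries more than \<open>e / 2\<close>.\<close>
    obtain H where H: "finite H" "variation ?\<mu> (- H) \<le> ennreal (e / 2)"
      using measure_of_functional_atomic[OF K disp, of "e / 2" "\<psi> o\<^sub>L T"] e by auto
    have "F \<in> sets borel" "H \<in> sets borel"
      using F H(1) by (auto intro: borel_closed[OF finite_imp_closed])
    then have bor: "H - F \<in> sets borel" "- F - H \<in> sets borel" "- H \<in> sets borel"
      by (simp_all add: Compl_eq_Diff_UNIV sets.Diff)
    have "- F = (H - F) \<union> (- F - H)" by blast
    then have "variation ?\<mu> (- F) \<le> variation ?\<mu> (H - F) + variation ?\<mu> (- F - H)"
      using variation_Un_le[OF rc bor(1,2)] by (metis Diff_disjoint Diff_Int_distrib2 Int_Diff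
          inf_commute Int_empty_right)
    also have "variation ?\<mu> (- F - H) \<le> variation ?\<mu> (- H)"
      using bor by (intro variation_mono) auto
    also note H(2)
    finally have "variation ?\<mu> (- F) \<le> variation ?\<mu> (H - F) + ennreal (e / 2)"
      by (simp add: add_left_mono)
    then have lt: "ennreal e < variation ?\<mu> (H - F) + ennreal (e / 2)"
      using \<psi>(2) variation_functional_measure[OF K disp m] by (simp add: less_le_trans)
    have "ennreal (e / 2) < variation ?\<mu> (H - F)"
    proof (rule ccontr)
      assume "\<not> ?thesis"
      then have "variation ?\<mu> (H - F) + ennreal (e / 2) \<le> ennreal (e / 2) + ennreal (e / 2)"
        by (intro add_right_mono) simp
      also have "\<dots> = ennreal e" using e by (simp flip: ennreal_plus)
      finally show False using lt by simp
    qed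
    also have "\<dots> \<le> semivariation m (H - F)"
      using variation_le_semivariation[OF \<psi>(1), of m "H -
          F"] variation_functional_measure[OF K disp m] by simp
    also have "H - F = (F \<union> H) - F" by blast
    finally show ?thesis using F H(1) by (intro exI[of _ "F \<union> H"]) auto
  qed
  have "\<exists>H. \<forall>n. finite (H n) \<and> (H n \<subseteq> H (Suc n) \<and> ennreal (e / 2) < semivariation m (H (Suc n) -
      H n))"
    by (rule dependent_nat_choice[where P="\<lambda>_. finite"]) (use step in auto)
  then obtain H where H: "\<And>n. finite (H n)" "\<And>n. H n \<subseteq> H (Suc n)"
    "\<And>n. ennreal (e / 2) < semivariation m (H (Suc n) - H n)" by blast
  define A where "A n = (\<Union>i. H i) - H n" for n
  have bor: "A n \<in> sets borel" "H (Suc n) - H n \<in> sets borel" for n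
    unfolding A_def using countable_finite[OF H(1)] by (auto intro!: countable_in_borel)
  have "incseq H" using H(2) by (rule incseq_SucI)
  then have "decseq A" unfolding A_def decseq_def incseq_def by blast
  moreover have "(\<Inter>i. A i) = {}" unfolding A_def by blast
  moreover have "range A \<subseteq> sets borel" using bor by blast
  ultimately have "(\<lambda>i. semivariation m (A i)) \<longlonglongrightarrow> 0"
    using sb unfolding strongly_bounded_def by blast
  moreover have "0 < ennreal (e / 2)" using e by simp
  ultimately have "\<forall>\<^sub>F i in sequentially. semivariation m (A i) < ennreal (e / 2)"
    by (rule order_tendstoD(2))
  then obtain n where "semivariation m (A n) < ennreal (e / 2)"
    unfolding eventually_sequentially by blast
  moreover have "semivariation m (H (Suc n) - H n) \<le> semivariation m (A n)"
    using bor by (intro semivariation_mono) (auto simp: A_def)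
  ultimately show False using H(3)[of n] by simp
qed

lemma has_integral_vm_atomic_estimate:
  fixes \<mu> :: "'k::t2_space set \<Rightarrow> 'x::real_normed_vector dual" and f :: "'k \<Rightarrow>\<^sub>C 'x"
  assumes \<mu>: "\<mu> \<in> rcabv" and int: "has_integral_vm \<mu> (apply_bcontfun f) i" and F: "finite F"
    and e: "variation \<mu> (- F) \<le> ennreal e" "0 \<le> e"
  shows "\<bar>i - (\<Sum>t\<in>F. blinfun_apply (\<mu> {t}) (f t))\<bar> \<le> e * norm f"
proof -
  obtain V where V: "0 \<le> V" "variation \<mu> UNIV = ennreal V"
    using \<mu> unfolding rcabv_def by (cases "variation \<mu> UNIV") auto
  \<comment> \<open>\<open>None\<close> is the complement of \<open>F\<close>, where
    \<open>f\<close> is replaced by \<open>0\<close> and the variation is small;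
    \<open>Some t\<close> is a single point, where there is no oscillation.\<close>
  let ?E = "\<lambda>j. case j of None \<Rightarrow> - F | Some t \<Rightarrow> {t}"
  let ?c = "\<lambda>j. case j of None \<Rightarrow> e | Some t \<Rightarrow> V"
  let ?x = "\<lambda>j. case j of None \<Rightarrow> 0 | Some t \<Rightarrow> f t"
  let ?d = "\<lambda>j. case j of None \<Rightarrow> norm f | Some t \<Rightarrow> 0"
  let ?J = "insert None (Some ` F)"
  have "- F \<in> sets borel" using F by (intro borel_open open_Compl finite_imp_closed)
  then have E: "?E j \<in> sets borel" for j by (cases j) auto
  have J: "(\<Sum>j\<in>?J. g j) = g None + (\<Sum>t\<in>F. g (Some t))" for g :: "'k option \<Rightarrow> real"
    using F by (simp add: sum.reindex)
  have "\<bar>i - (\<Sum>j\<in>?J. blinfun_apply (\<mu> (?E j)) (?x j))\<bar> \<le> (\<Sum>j\<in>?J. ?c j * ?d j)"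
  proof (rule has_integral_vm_partition_estimate[OF \<mu> int])
    show "disjoint_family_on ?E ?J" by (auto simp: disjoint_family_on_def)
    show "(\<Union>j\<in>?J. ?E j) = UNIV" by auto
    show "variation \<mu> (?E j) \<le> ennreal (?c j)" for j
      using e(1) V(2) variation_mono[of "?E j" UNIV \<mu>] E[of j] by (cases j) auto
    show "norm (f t - ?x j) \<le> ?d j" if "t \<in> ?E j" for j t
      using that norm_bounded[of f t] by (cases j) auto
  qed (use F E e V in \<open>auto split: option.split\<close>)
  then show ?thesis unfolding J by (simp add: blinfun.zero_right)
qed

lemma norm_functional_le:
  fixes L :: "'a::real_normed_vector dual"
  assumes "\<And>x. norm x \<le> 1 \<Longrightarrow> \<bar>blinfun_apply L x\<bar> \<le> c"
  shows "norm L \<le> c"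
proof (rule ccontr)
  assume "\<not> ?thesis"
  then obtain x where "norm x \<le> 1" "c < norm (blinfun_apply L x)"
    using blinfun_norm_attained_approx[of c L] by auto
  with assms[of x] show False by simp
qed

section \<open>Finite approximation of \<open>T\<close> and \<open>m(A)\<close>, and values in
  \<open>Y\<close>\<close>

locale strongly_bounded_operator =
  fixes T :: "('k::t2_space \<Rightarrow>\<^sub>C 'x::real_normed_vector) \<Rightarrow>\<^sub>L 'y::banach"
    and m :: "'k set \<Rightarrow> 'x \<Rightarrow>\<^sub>L 'y bidual"
  assumes K: "compact (UNIV :: 'k set)" and disp: "dispersed (UNIV :: 'k set)"
    and m: "representing_measure m T" and sb: "strongly_bounded m"
begin

lemma singleton_borel: "{t :: 'k} \<in> sets borel"
  by (intro borel_closed) simp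

text \<open>Semivariation is a supremum over unit functionals, so one \<open>F\<close> serves all of
  them, and the scalar estimates become norm estimates in the bidual. The same \<open>F\<close> also
  serves all \<open>A\<close>.\<close>

lemma finite_sum_estimate:
  assumes e: "0 < e"
  obtains F where "finite F"
    "\<And>f. norm (blinfun_apply canonical_embedding (blinfun_apply T f) -
        (\<Sum>t\<in>F. blinfun_apply (m {t}) (apply_bcontfun f t))) \<le> e * norm f"
    "\<And>A x. A \<in> sets borel \<Longrightarrow> norm (blinfun_apply (m A) x - (\<Sum>t\<in>A \<inter> F. blinfun_apply (m {t}) x)) \<le>
        e * norm x"
proof -
  obtain F where F: "finite F" "semivariation m (- F) \<le> ennreal e"
    using strongly_bounded_uniformly_atomic[OF K disp m sb e] by blast
  have var: "variation (measure_of_functional (\<psi> o\<^sub>L T)) (- F) \<le> ennreal e" if "norm \<psi> \<le> 1" for \<psi>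
    using variation_le_semivariation[OF that, of m "- F"] F(2)
    unfolding variation_functional_measure[OF K disp m] by (rule order_trans)
  have rep: "represents (measure_of_functional (\<psi> o\<^sub>L T)) (\<psi> o\<^sub>L T)" for \<psi>
    by (rule represents_measure_of_functional[OF K disp])
  note m_apply = representing_measure_apply[OF K disp m]
  show thesis
  proof (rule that[OF F(1)])
    fix f
    show "norm (blinfun_apply canonical_embedding (blinfun_apply T f) -
        (\<Sum>t\<in>F. blinfun_apply (m {t}) (apply_bcontfun f t))) \<le> e * norm f"
    proof (rule norm_functional_le)
      fix \<psi> :: "'y dual" assume \<psi>: "norm \<psi> \<le> 1"
      have "\<bar>blinfun_apply (\<psi> o\<^sub>L T) f - (\<Sum>t\<in>F. blinfun_apply (measure_of_functional (\<psi> o\<^sub>L T)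
          {t}) (f t))\<bar> \<le> e * norm f"
        using rep[of \<psi>] var[OF \<psi>] e F(1) unfolding represents_def
        by (intro has_integral_vm_atomic_estimate) auto
      then show "\<bar>blinfun_apply (blinfun_apply canonical_embedding (blinfun_apply T f) -
          (\<Sum>t\<in>F. blinfun_apply (m {t}) (f t))) \<psi>\<bar> \<le> e * norm f"
        by (simp add: blinfun.diff_left blinfun.sum_left m_apply[OF singleton_borel])
    qed
  next
    fix A :: "'k set" and x assume A: "A \<in> sets borel"
    show "norm (blinfun_apply (m A) x - (\<Sum>t\<in>A \<inter> F. blinfun_apply (m {t}) x)) \<le> e * norm x"
    proof (rule norm_functional_le)
      fix \<psi> :: "'y dual" assume \<psi>: "norm \<psi> \<le> 1"
      let ?\<mu> = "measure_of_functional (\<psi> o\<^sub>L T)"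
      have rc: "?\<mu> \<in> rcabv" using rep by (simp add: represents_def)
      have FB: "F \<in> sets borel" using F(1) by (intro borel_closed finite_imp_closed)
      have "?\<mu> (\<Union>t\<in>A \<inter> F. {t}) = (\<Sum>t\<in>A \<inter> F. ?\<mu> {t})"
        using F(1) singleton_borel by (intro rcabv_finite_UN[OF rc]) (auto simp:
            disjoint_family_on_def)
      moreover have "?\<mu> ((A \<inter> F) \<union> (A - F)) = ?\<mu> (A \<inter> F) + ?\<mu> (A - F)"
        using A FB by (intro rcabv_Un[OF rc]) auto
      moreover have "(A \<inter> F) \<union> (A - F) = A" by blast
      ultimately have "?\<mu> A = (\<Sum>t\<in>A \<inter> F. ?\<mu> {t}) + ?\<mu> (A - F)" by simp
      then have "blinfun_apply (blinfun_apply (m A) x - (\<Sum>t\<in>A \<inter> F. blinfun_apply (m {t}) x)) \<psi> =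
          blinfun_apply (?\<mu> (A - F)) x"
        by (simp add: blinfun.diff_left blinfun.sum_left blinfun.add_left m_apply[OF
            singleton_borel] m_apply[OF A])
      moreover have "norm (?\<mu> (A - F)) \<le> e"
      proof -
        have "ennreal (norm (?\<mu> (A - F))) \<le> variation ?\<mu> (A - F)" using A FB
            by (intro norm_le_variation) auto
        also have "\<dots> \<le> variation ?\<mu> (- F)" using A FB by (intro variation_mono) auto
        also note var[OF \<psi>]
        finally show ?thesis using e by (simp add: ennreal_le_iff)
      qed
      then have "norm (blinfun_apply (?\<mu> (A - F)) x) \<le> e * norm x"
        by (intro order_trans[OF norm_blinfun] mult_right_mono) auto
      ultimately show "\<bar>blinfun_apply (blinfun_apply (m A) x -
          (\<Sum>t\<in>A \<inter> F. blinfun_apply (m {t}) x)) \<psi>\<bar> \<le> e * norm x"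
        by simp
    qed
  qed
qed

text \<open>If \<open>h\<close> is \<open>1\<close> on \<open>A \<inter> F\<close> and
  \<open>0\<close> on \<open>F - A\<close>, both terms are within \<open>e / 2 * norm x\<close> of
  the same finite sum; these sets are closed because they are finite. As \<open>h\<close> does not
  depend on \<open>x\<close>, a whole sequence can be treated at once.\<close>

lemma urysohn_estimate:
  assumes A: "A \<in> sets borel" and e: "0 < e"
  obtains h where "\<And>x. norm (blinfun_apply canonical_embedding (blinfun_apply T (bcontfun_scale h
      (const_bcontfun x))) - blinfun_apply (m A) x) \<le> e * norm x"
proof -
  have "0 < e / 2" using e by simp
  then obtain F where F: "finite F"
    "\<And>f. norm (blinfun_apply canonical_embedding (blinfun_apply T f) -
        (\<Sum>t\<in>F. blinfun_apply (m {t}) (apply_bcontfun f t))) \<le> e / 2 * norm f"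
    "\<And>A x. A \<in> sets borel \<Longrightarrow> norm (blinfun_apply (m A) x - (\<Sum>t\<in>A \<inter> F. blinfun_apply (m {t}) x)) \<le>
        e / 2 * norm x"
    by (rule finite_sum_estimate) blast
  have cl: "closed (A \<inter> F)" "closed (F - A)" "A \<inter> F \<inter> (F - A) = {}"
    using F(1) by (auto intro!: finite_imp_closed)
  from compact_urysohn[OF K cl] obtain h :: "'k \<Rightarrow>\<^sub>C real" where h: "\<forall>t. 0 \<le> apply_bcontfun h t"
      "\<forall>t. h t \<le> 1"
      "\<forall>t\<in>A \<inter> F. h t = 1" "\<forall>t\<in>F - A. h t = 0" by blast
  show thesis
  proof (rule that)
    fix x :: 'x
    let ?f = "bcontfun_scale h (const_bcontfun x)"
    have "norm ?f \<le> norm (const_bcontfun x :: 'k \<Rightarrow>\<^sub>C 'x)" using h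
        by (intro norm_bcontfun_scale_le) auto
    also have "\<dots> \<le> norm x" by (rule norm_bound) (simp add: const_bcontfun.rep_eq)
    finally have nf: "norm ?f \<le> norm x" .
    have "(\<Sum>t\<in>F. blinfun_apply (m {t}) (?f t)) = (\<Sum>t\<in>A \<inter> F. blinfun_apply (m {t}) x)"
    proof (rule sum.mono_neutral_cong_right[OF F(1)])
      show "\<forall>t\<in>F - A \<inter> F. blinfun_apply (m {t}) (?f t) = 0"
      proof
        fix t assume "t \<in> F - A \<inter> F"
        then have "h t = 0" using h(4) by blast
        then show "blinfun_apply (m {t}) (?f t) = 0" by (simp add: blinfun.zero_right)
      qed
    qed (use h(3) in \<open>auto simp: const_bcontfun.rep_eq\<close>)
    with F(2)[of ?f] have "norm (blinfun_apply canonical_embedding (blinfun_apply T ?f) -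
        (\<Sum>t\<in>A \<inter> F. blinfun_apply (m {t}) x)) \<le> e / 2 * norm ?f"
      by simp
    also have "\<dots> \<le> e / 2 * norm x" using nf e by (intro mult_left_mono) auto
    finally show "norm (blinfun_apply canonical_embedding (blinfun_apply T ?f) -
        blinfun_apply (m A) x) \<le> e * norm x"
      using F(3)[OF A, of x] norm_triangle_sub norm_diff_triangle_le norm_minus_commute
      by (smt (verit) field_sum_of_halves distrib_right)
  qed
qed

text \<open>\<open>m A x\<close> is a limit of canonical images of vectors \<open>T(h x)\<close>;
  isometry makes these vectors Cauchy, and \<open>Y\<close> is complete.\<close>

lemma range_in_space:
  assumes A: "A \<in> sets borel"
  shows "\<exists>y. blinfun_apply canonical_embedding y = blinfun_apply (m A) x"
proof -
  have "\<exists>y. norm (blinfun_apply canonical_embedding y - blinfun_apply (m A) x) \<le>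
      1 / real (Suc n) * norm x" for n
    using urysohn_estimate[OF A, of "1 / real (Suc n)"]
        by (metis zero_less_divide_1_iff of_nat_0_less_iff zero_less_Suc)
  then obtain y where y: "\<And>n. norm (blinfun_apply canonical_embedding (y n) -
      blinfun_apply (m A) x) \<le> 1 / real (Suc n) * norm x"
    by metis
  have "(\<lambda>n. 1 / real (Suc n) * norm x) \<longlonglongrightarrow> 0"
    using tendsto_mult_left_zero[OF LIMSEQ_Suc[OF lim_1_over_n]] .
  then have "(\<lambda>n. blinfun_apply canonical_embedding (y n) - blinfun_apply (m A) x) \<longlonglongrightarrow> 0"
    by (rule Lim_null_comparison[OF always_eventually[OF allI[OF y]]])
  then have lim: "(\<lambda>n. blinfun_apply canonical_embedding (y n)) \<longlonglongrightarrow> blinfun_apply (m A) x"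
    by (rule LIM_zero_cancel)
  then have "Cauchy (\<lambda>n. blinfun_apply canonical_embedding (y n))" by (rule LIMSEQ_imp_Cauchy)
  then have "Cauchy y"
    unfolding Cauchy_def dist_norm blinfun.diff_right[symmetric] norm_canonical_embedding .
  then obtain z where "y \<longlonglongrightarrow> z" using Cauchy_convergent_iff convergent_def by blast
  then have "(\<lambda>n. blinfun_apply canonical_embedding (y n)) \<longlonglongrightarrow> blinfun_apply canonical_embedding z"
    by (intro tendsto_intros)
  with lim show ?thesis using LIMSEQ_unique by blast
qed

text \<open>Discharges the \<open>THE\<close>: the pointwise preimages form a bounded linear map,
  and injectivity of the embedding makes it the only one.\<close>

lemma into_space_apply:
  assumes A: "A \<in> sets borel"
  shows "blinfun_apply canonical_embedding (blinfun_apply (into_space (m A)) x) =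
      blinfun_apply (m A) x"
proof -
  obtain g where g: "\<And>x. blinfun_apply canonical_embedding (g x) = blinfun_apply (m A) x"
    using range_in_space[OF A] by metis
  have "bounded_linear g"
  proof (rule bounded_linear_intro)
    fix x y c
    show "g (x + y) = g x + g y" "g (c *\<^sub>R x) = c *\<^sub>R g x"
      by (rule injD[OF inj_canonical_embedding],
          simp add: g blinfun.add_right blinfun.scaleR_right)+
    show "norm (g x) \<le> norm x * norm (m A)"
      using norm_blinfun[of "m A" x] norm_canonical_embedding[of "g x"]
          by (simp add: g mult.commute)
  qed
  then have "canonical_embedding o\<^sub>L Blinfun g = m A"
    by (intro blinfun_eqI) (simp add: bounded_linear_Blinfun_apply g)
  moreover have "S = S'" if "canonical_embedding o\<^sub>L S = m A" "canonical_embedding o\<^sub>L S' = m A"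
    for S S' :: "'x \<Rightarrow>\<^sub>L 'y"
  proof (rule blinfun_eqI, rule injD[OF inj_canonical_embedding])
    fix x
    show "blinfun_apply canonical_embedding (blinfun_apply S x) =
        blinfun_apply canonical_embedding (blinfun_apply S' x)"
      using that by (metis blinfun_apply_blinfun_compose)
  qed
  ultimately have "\<exists>!S. canonical_embedding o\<^sub>L S = m A" by blast
  then have "canonical_embedding o\<^sub>L into_space (m A) = m A"
    unfolding into_space_def by (rule theI')
  then show ?thesis by (metis blinfun_apply_blinfun_compose)
qed

lemma operator_finite_sum_estimate:
  assumes e: "0 < e"
  obtains F where "finite F"
    "\<And>f. norm (blinfun_apply T f - (\<Sum>t\<in>F. blinfun_apply (into_space (m {t})) (apply_bcontfun f
        t))) \<le> e * norm f"
proof -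
  obtain F where F: "finite F"
    "\<And>f. norm (blinfun_apply canonical_embedding (blinfun_apply T f) -
        (\<Sum>t\<in>F. blinfun_apply (m {t}) (apply_bcontfun f t))) \<le> e * norm f"
    "\<And>A x. A \<in> sets borel \<Longrightarrow> norm (blinfun_apply (m A) x - (\<Sum>t\<in>A \<inter> F. blinfun_apply (m {t}) x)) \<le>
        e * norm x"
    using e by (rule finite_sum_estimate) blast
  have "norm (blinfun_apply canonical_embedding (blinfun_apply T f -
      (\<Sum>t\<in>F. blinfun_apply (into_space (m {t})) (f t)))) \<le> e * norm f" for f
    using F(2)[of f] by (simp add: blinfun.diff_right blinfun.sum_right into_space_apply[OF
        singleton_borel] del: norm_canonical_embedding)
  then have "norm (blinfun_apply T f - (\<Sum>t\<in>F. blinfun_apply (into_space (m {t})) (f t))) \<le>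
      e * norm f" for f
    by simp
  with F(1) show thesis by (rule that)
qed

lemma operator_urysohn_estimate:
  assumes A: "A \<in> sets borel" and e: "0 < e"
  obtains h where "\<And>x. norm (blinfun_apply T (bcontfun_scale h (const_bcontfun x)) -
      blinfun_apply (into_space (m A)) x) \<le> e * norm x"
proof -
  obtain h where h: "\<And>x. norm (blinfun_apply canonical_embedding (blinfun_apply T (bcontfun_scale
      h (const_bcontfun x))) - blinfun_apply (m A) x) \<le> e * norm x"
    using urysohn_estimate[OF A e] by blast
  have "norm (blinfun_apply canonical_embedding (blinfun_apply T (bcontfun_scale h (const_bcontfun
      x)) - blinfun_apply (into_space (m A)) x)) \<le> e * norm x" for x
    using h[of x] by (simp add: blinfun.diff_right into_space_apply[OF A] del:
        norm_canonical_embedding)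
  then have "norm (blinfun_apply T (bcontfun_scale h (const_bcontfun x)) -
      blinfun_apply (into_space (m A)) x) \<le> e * norm x" for x
    by simp
  then show thesis by (rule that)
qed

end

section \<open>Transfer between \<open>T\<close> and \<open>m(A)\<close>\<close>

lemma tendsto_zero_uniform_approx:
  fixes b :: "nat \<Rightarrow> real"
  assumes "\<And>e. 0 < e \<Longrightarrow> \<exists>a. a \<longlonglongrightarrow> 0 \<and> (\<forall>n. \<bar>b n - a n\<bar> \<le> e * c)" "0 \<le> c"
  shows "b \<longlonglongrightarrow> 0"
proof (rule LIMSEQ_I)
  fix r :: real assume r: "0 < r"
  define e where "e = r / (2 * (c + 1))"
  have "0 < e" "e * c < r" unfolding e_def using r assms(2)
      by (auto simp: field_simps add_nonneg_pos)
  have ec: "e * c \<le> r / 2" unfolding e_def using r assms(2)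
      by (simp add: field_simps add_nonneg_pos)
  obtain a where a: "a \<longlonglongrightarrow> 0" "\<And>n. \<bar>b n - a n\<bar> \<le> e * c" using assms(1)[OF \<open>0 < e\<close>] by blast
  obtain N where N: "\<And>n. N \<le> n \<Longrightarrow> \<bar>a n\<bar> < r / 2"
    using LIMSEQ_D[OF a(1), of "r / 2"] r by auto
  have "\<bar>b n\<bar> < r" if "N \<le> n" for n
    using a(2)[of n] N[OF that] ec by linarith
  then show "\<exists>N. \<forall>n\<ge>N. norm (b n - 0) < r" by auto
qed

lemma (in strongly_bounded_operator) null_pairing_transfer:
  assumes boundedC: "\<And>f :: nat \<Rightarrow> 'k \<Rightarrow>\<^sub>C 'x. PC f \<Longrightarrow> bounded (range f)"
    and boundedX: "\<And>x :: nat \<Rightarrow> 'x. PX x \<Longrightarrow> bounded (range x)"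
    and boundedQ: "\<And>\<psi> :: nat \<Rightarrow> 'y dual. Q \<psi> \<Longrightarrow> bounded (range \<psi>)"
    and scale: "\<And>h x. PX x \<Longrightarrow> PC (\<lambda>n. bcontfun_scale h (const_bcontfun (x n)))"
    and point: "\<And>f t. PC f \<Longrightarrow> PX (\<lambda>n. apply_bcontfun (f n) t)"
  shows "(\<forall>f \<psi>. PC f \<and> Q \<psi> \<longrightarrow> (\<lambda>n. blinfun_apply (\<psi> n) (blinfun_apply T (f n))) \<longlonglongrightarrow> 0) \<longleftrightarrow>
    (\<forall>A\<in>sets borel. \<forall>x \<psi>. PX x \<and> Q \<psi> \<longrightarrow>
      (\<lambda>n. blinfun_apply (\<psi> n) (blinfun_apply (into_space (m A)) (x n))) \<longlonglongrightarrow> 0)"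
    (is "?L \<longleftrightarrow> ?R")
proof
  assume L: ?L
  show ?R
  proof (intro ballI allI impI)
    fix A x \<psi> assume A: "(A :: 'k set) \<in> sets borel" and *: "PX x \<and> Q \<psi>"
    obtain M where M: "0 < M" "\<And>n. norm (x n) \<le> M" using boundedX * unfolding bounded_pos
        by (metis rangeI)
    obtain B where B: "0 < B" "\<And>n. norm (\<psi> n) \<le> B" using boundedQ * unfolding bounded_pos
        by (metis rangeI)
    show "(\<lambda>n. blinfun_apply (\<psi> n) (blinfun_apply (into_space (m A)) (x n))) \<longlonglongrightarrow> 0"
    proof (rule tendsto_zero_uniform_approx)
      fix e :: real assume e: "0 < e"
      obtain h where h: "\<And>x. norm (blinfun_apply T (bcontfun_scale h (const_bcontfun x)) -
          blinfun_apply (into_space (m A)) x) \<le> e * norm x"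
        using operator_urysohn_estimate[OF A e] by blast
      let ?a = "\<lambda>n. blinfun_apply (\<psi> n) (blinfun_apply T (bcontfun_scale h (const_bcontfun (x n))))"
      have "?a \<longlonglongrightarrow> 0" using L scale * by blast
      moreover have "\<bar>blinfun_apply (\<psi> n) (blinfun_apply (into_space (m A)) (x n)) - ?a n\<bar> \<le>
          e * (M * B)" for n
      proof -
        have "\<bar>blinfun_apply (\<psi> n) (blinfun_apply (into_space (m A)) (x n)) - ?a n\<bar> \<le>
            norm (\<psi> n) * (e * norm (x n))"
          unfolding blinfun.diff_right[symmetric] using h[of "x n"]
            by (intro functional_le) (simp add: norm_minus_commute)
        also have "\<dots> \<le> B * (e * M)" using M B e by (intro mult_mono) auto
        finally show ?thesis by (simp add: mult_ac)
      qed
      ultimately show "\<exists>a. a \<longlonglongrightarrow> 0 \<and> (\<forall>n. \<bar>blinfun_apply (\<psi> n) (blinfun_apply (into_space (m A)) (x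
          n)) - a n\<bar> \<le> e * (M * B))" by blast
    qed (use M B in simp)
  qed
next
  assume R: ?R
  show ?L
  proof (intro allI impI)
    fix f \<psi> assume *: "PC f \<and> Q \<psi>"
    obtain M where M: "0 < M" "\<And>n. norm (f n) \<le> M" using boundedC * unfolding bounded_pos
        by (metis rangeI)
    obtain B where B: "0 < B" "\<And>n. norm (\<psi> n) \<le> B" using boundedQ * unfolding bounded_pos
        by (metis rangeI)
    show "(\<lambda>n. blinfun_apply (\<psi> n) (blinfun_apply T (f n))) \<longlonglongrightarrow> 0"
    proof (rule tendsto_zero_uniform_approx)
      fix e :: real assume e: "0 < e"
      obtain F where F: "finite F"
        "\<And>f. norm (blinfun_apply T f - (\<Sum>t\<in>F. blinfun_apply (into_space (m {t})) (apply_bcontfun f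
            t))) \<le> e * norm f"
        using operator_finite_sum_estimate[OF e] by blast
      let ?a = "\<lambda>n. \<Sum>t\<in>F. blinfun_apply (\<psi> n) (blinfun_apply (into_space (m {t})) (apply_bcontfun
          (f n) t))"
      have "?a \<longlonglongrightarrow> 0"
      proof (rule tendsto_null_sum)
        fix t
        show "(\<lambda>n. blinfun_apply (\<psi> n) (blinfun_apply (into_space (m {t})) (apply_bcontfun (f n)
            t))) \<longlonglongrightarrow> 0"
          using R[rule_format, OF singleton_borel, of "\<lambda>n. apply_bcontfun (f n) t" \<psi>] point *
            by blast
      qed
      moreover have "\<bar>blinfun_apply (\<psi> n) (blinfun_apply T (f n)) - ?a n\<bar> \<le> e * (M * B)" for n
      proof -
        have "\<bar>blinfun_apply (\<psi> n) (blinfun_apply T (f n)) - ?a n\<bar> \<le> norm (\<psi> n) * (e * norm (f n))"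
          unfolding blinfun.sum_right[symmetric] blinfun.diff_right[symmetric] using F(2)
            by (rule functional_le)
        also have "\<dots> \<le> B * (e * M)" using M B e by (intro mult_mono) auto
        finally show ?thesis by (simp add: mult_ac)
      qed
      ultimately show "\<exists>a. a \<longlonglongrightarrow> 0 \<and> (\<forall>n. \<bar>blinfun_apply (\<psi> n) (blinfun_apply T (f n)) - a n\<bar> \<le>
          e * (M * B))" by blast
    qed (use M B in simp)
  qed
qed

text \<open>Bundled as an operator so that functionals on \<open>C(K,X)\<close> can be pulled back
  to \<open>X\<close>.\<close>

lemma bcontfun_scale_const_blinfun:
  fixes h :: "'k::topological_space \<Rightarrow>\<^sub>C real"
  shows "\<exists>L :: 'x::real_normed_vector \<Rightarrow>\<^sub>L ('k \<Rightarrow>\<^sub>C 'x).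
    \<forall>x. blinfun_apply L x = bcontfun_scale h (const_bcontfun x)"
proof -
  have "bounded_linear (\<lambda>x :: 'x. bcontfun_scale h (const_bcontfun x))"
  proof (rule bounded_linear_intro)
    fix x y :: 'x and c :: real
    show "bcontfun_scale h (const_bcontfun (x + y)) = bcontfun_scale h (const_bcontfun x) +
        bcontfun_scale h (const_bcontfun y)"
      by (rule bcontfun_eqI) (simp add: const_bcontfun.rep_eq scaleR_add_right)
    show "bcontfun_scale h (const_bcontfun (c *\<^sub>R x)) = c *\<^sub>R bcontfun_scale h (const_bcontfun x)"
      by (rule bcontfun_eqI) (simp add: const_bcontfun.rep_eq)
    show "norm (bcontfun_scale h (const_bcontfun x)) \<le> norm x * norm h"
    proof (rule norm_bound)
      fix t
      have "norm x * norm (h t) \<le> norm x * norm h" by (intro mult_left_mono norm_bounded) auto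
      then show "norm (bcontfun_scale h (const_bcontfun x) t) \<le> norm x * norm h"
        by (simp add: const_bcontfun.rep_eq mult.commute)
    qed
  qed
  then show ?thesis
    by (intro exI[of _ "Blinfun (\<lambda>x. bcontfun_scale h (const_bcontfun x))"])
      (simp add: bounded_linear_Blinfun_apply)
qed

lemma bcontfun_evaluation_blinfun:
  "\<exists>L :: ('k::topological_space \<Rightarrow>\<^sub>C 'x::real_normed_vector) \<Rightarrow>\<^sub>L 'x.
    \<forall>f. blinfun_apply L f = apply_bcontfun f t"
proof -
  have "bounded_linear (\<lambda>f :: 'k \<Rightarrow>\<^sub>C 'x. apply_bcontfun f t)"
    by (rule bounded_linear_intro[where K=1]) (auto simp: norm_bounded)
  then show ?thesis
    by (intro exI[of _ "Blinfun (\<lambda>f. apply_bcontfun f t)"]) (simp add: bounded_linear_Blinfun_apply)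
qed

theorem corollary11:
  fixes p :: real
    and T :: "('k::t2_space \<Rightarrow>\<^sub>C 'x::banach) \<Rightarrow>\<^sub>L 'y::banach"
    and m :: "'k set \<Rightarrow> 'x \<Rightarrow>\<^sub>L 'y bidual"
  assumes "1 \<le> p"
    and "compact (UNIV :: 'k set)"
    and "dispersed (UNIV :: 'k set)"
    and "representing_measure m T"
    and "strongly_bounded m"
  shows
    "(weak_dunford_pettis T \<longleftrightarrow>
        (\<forall>A \<in> sets borel. weak_dunford_pettis (into_space (m A)))) \<and>
     (weak_star_dunford_pettis T \<longleftrightarrow>
        (\<forall>A \<in> sets borel. weak_star_dunford_pettis (into_space (m A)))) \<and>
     (weak_p_convergent p T \<longleftrightarrow>
        (\<forall>A \<in> sets borel. weak_p_convergent p (into_space (m A)))) \<and>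
     (weak_star_p_convergent p T \<longleftrightarrow>
        (\<forall>A \<in> sets borel. weak_star_p_convergent p (into_space (m A))))"
proof -
  interpret strongly_bounded_operator T m
    using assms by unfold_locales
  have p: "0 < p" using assms(1) by simp
  \<comment> \<open>Multiplication by a fixed \<open>h\<close> and evaluation at a point are bounded
    operators, and these preserve weak nullness and weak \<open>p\<close>-summability.\<close>
  have null_scale: "weakly_null (\<lambda>n. bcontfun_scale h (const_bcontfun (x n)) :: 'k \<Rightarrow>\<^sub>C 'x)" if
      "weakly_null x"
    for h :: "'k \<Rightarrow>\<^sub>C real" and x
  proof -
    obtain L :: "'x \<Rightarrow>\<^sub>L ('k \<Rightarrow>\<^sub>C 'x)" where "\<forall>x. blinfun_apply L x =
        bcontfun_scale h (const_bcontfun x)"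
      using bcontfun_scale_const_blinfun[of h] by blast
    with weakly_null_image[OF that, of L] show ?thesis by simp
  qed
  have summable_scale: "weakly_p_summable p (\<lambda>n. bcontfun_scale h (const_bcontfun (x n)) :: 'k \<Rightarrow>\<^sub>C
      'x)" if "weakly_p_summable p x"
    for h :: "'k \<Rightarrow>\<^sub>C real" and x
  proof -
    obtain L :: "'x \<Rightarrow>\<^sub>L ('k \<Rightarrow>\<^sub>C 'x)" where "\<forall>x. blinfun_apply L x =
        bcontfun_scale h (const_bcontfun x)"
      using bcontfun_scale_const_blinfun[of h] by blast
    with weakly_p_summable_image[OF that, of L] show ?thesis by simp
  qed
  have null_point: "weakly_null (\<lambda>n. apply_bcontfun (f n) t)" if "weakly_null f"
      for f :: "nat \<Rightarrow> 'k \<Rightarrow>\<^sub>C 'x" and t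
  proof -
    obtain L :: "('k \<Rightarrow>\<^sub>C 'x) \<Rightarrow>\<^sub>L 'x" where "\<forall>f. blinfun_apply L f = apply_bcontfun f t"
      using bcontfun_evaluation_blinfun[of t] by blast
    with weakly_null_image[OF that, of L] show ?thesis by simp
  qed
  have summable_point: "weakly_p_summable p (\<lambda>n. apply_bcontfun (f n) t)" if "weakly_p_summable p
      f" for f :: "nat \<Rightarrow> 'k \<Rightarrow>\<^sub>C 'x" and t
  proof -
    obtain L :: "('k \<Rightarrow>\<^sub>C 'x) \<Rightarrow>\<^sub>L 'x" where "\<forall>f. blinfun_apply L f = apply_bcontfun f t"
      using bcontfun_evaluation_blinfun[of t] by blast
    with weakly_p_summable_image[OF that, of L] show ?thesis by simp
  qed
  \<comment> \<open>Weak-star null sequences are bounded because \<open>Y\<close> is complete, the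
    others because a dual space is.\<close>
  note bounded = weakly_null_bounded weak_star_null_bounded
    weakly_p_summable_imp_weakly_null[OF p, THEN weakly_null_bounded]
  show ?thesis
    unfolding weak_dunford_pettis_def weak_star_dunford_pettis_def weak_p_convergent_def
      weak_star_p_convergent_def
    by (intro conjI null_pairing_transfer[where PC=weakly_null and PX=weakly_null and Q=weakly_null]
        null_pairing_transfer[where PC=weakly_null and PX=weakly_null and Q=weak_star_null]
        null_pairing_transfer[where PC="weakly_p_summable p" and PX="weakly_p_summable p" and
            Q=weakly_null]
        null_pairing_transfer[where PC="weakly_p_summable p" and PX="weakly_p_summable p" and
            Q=weak_star_null])
      (auto intro: bounded null_scale null_point summable_scale summable_point)
qed

end
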